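(* Fix a constant $c\in(0,1/2)$ and let $(\mathsf{Prove},\mathsf{Verify})$ be the protocol defined in the context, with its biased oracle instantiated as $H=H_F$ from the standard (uniform) quantum random oracle $F$. Then this protocol, relative to $F$, satisfies $(Q,h_\infty)$-certifiable min-entropy for every $Q=Q(\lambda)=2^{o(\lambda^c)}$ and every $h_\infty=h_\infty(\lambda)=o(\lambda^c)$.
   Context: **Code.** For sufficiently large $\lambda\in\mathbb N$ set $q=2^{2\lfloor\log_2\lambda\rfloor}$, $\gamma$ an arbitrary generator of $\mathbb F_q^*$, $m=2^{\lfloor\log_2\lambda\rfloor}+1$, $N=q-1$, $n=N/m=2^{\lfloor\log_2\lambda\rfloor}-1$, $R=\frac{1}{10\sqrt n}$, $k=\lfloor RN\rfloor$, $\Sigma=\mathbb F_q^m$. The code $C=C_\lambda\subseteq\Sigma^n$ is the folded Reed–Solomon code $$C=\Big\{\big[(f(\gamma^{jm+1}),f(\gamma^{jm+2}),\dots,f(\gamma^{jm+m}))\big]_{j=0}^{n-1}: f\in\mathbb F_q[x],\ \deg f\le k\Big\}.$$ **Random oracle and its biased version.** The quantum random oracle $F$ is a uniformly random function taking any bitstring in $\{0,1\}^*$ to a uniformly random bitstring of any desired length (values on distinct inputs independent); algorithms may query it in superposition. Let $p$ be the unique power of $1/2$ with $\frac1{80\sqrt n}<p\le\frac1{40\sqrt n}$, and write $p=2^{-d}$. Define $H_F:[n]\times\Sigma\to\{0,1\}$ by: represent $(i,x)$ as a bitstring (by a fixed injective encoding), query $F$ on it, truncate the output to $d$ bits, and set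 $H_F(i,x)=1$ iff the result is $1^d$. Thus the values $H_F(i,x)$ are independent and each equals $1$ with probability $p$. Write $H=H_F$, $H_i=H(i,\cdot)$. **Verifier.** $\mathsf{Verify}^{F}(1^\lambda,1^{h_\infty},\pi)$: if $\pi=\bot$ output $\bot$. Otherwise parse $\pi=\mathbf x=(x_1,\dots,x_n)\in\Sigma^n$; if $\mathbf x\in C$ and $H_i(x_i)=0$ for all $i\in[n]$, output $\mathbf x$; otherwise output $\bot$. (The honest prover $\mathsf{Prove}$ is a quantum polynomial-time algorithm that tries to output such an $\mathbf x$; the property below depends only on $\mathsf{Verify}$.) **$(Q,h_\infty)$-certifiable min-entropy relative to $F$** (for a function $Q=Q(\lambda)$ and a polynomially bounded $h_\infty=h_\infty(\lambda)$): for every computationally unbounded adversary $\mathcal B$ making at most $Q$ quantum queries to $F$ and every inverse-polynomial $\delta(\lambda)=\lambda^{-e}$, $e\in\mathbb N$, there is a negligible function $\mathrm{negl}$ such that $$\Pr_F\Big[\Pr\big[\mathsf{Verify}^F(1^\lambda,1^{h_\infty},\mathcal B^F(1^\lambda,1^{h_\infty}))\ne\bot\big]\ge\delta(\lambda)\ \wedge\ H_\infty\big(\mathcal B^F_\top(1^\lambda,1^{h_\infty})\big)\le h_\infty(\lambda)\Big]\le\mathrm{negl}(\lambda),$$ where $\mathcal B^F_\top(1^\lambda,1^{h_\infty})$ is the distribution of $\mathsf{Verify}^F(1^\lambda,1^{h_\infty},\mathcal B^F(1^\lambda,1^{h_\infty}))$ conditioned on not being $\bot$ (for fixed $F$), and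 $H_\infty(D)=-\log_2\max_z\Pr[D=z]$ is min-entropy. *)

theory Defs
  imports
    "HOL-Probability.Probability"
    "HOL-Library.Landau_Symbols"
    "HOL-Algebra.Polynomials"
    "HOL-Algebra.Multiplicative_Group"
begin

definition lg :: "nat \<Rightarrow> nat" where
  "lg l = nat \<lfloor>log 2 (real l)\<rfloor>"

definition par_q :: "nat \<Rightarrow> nat" where
  "par_q l = 2 ^ (2 * lg l)"

definition par_m :: "nat \<Rightarrow> nat" where
  "par_m l = 2 ^ lg l + 1"

definition par_N :: "nat \<Rightarrow> nat" where
  "par_N l = par_q l - 1"

definition par_n :: "nat \<Rightarrow> nat" where
  "par_n l = par_N l div par_m l"

definition par_R :: "nat \<Rightarrow> real" where
  "par_R l = 1 / (10 * sqrt (real (par_n l)))"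

definition par_k :: "nat \<Rightarrow> nat" where
  "par_k l = nat \<lfloor>par_R l * real (par_N l)\<rfloor>"

lemma par_n_eq: "par_n l = 2 ^ lg l - 1" and par_m_dvd_par_N: "par_m l dvd par_N l"
proof -
  have "a ^ 2 - 1 = (a - 1) * (a + 1)" for a :: nat
    by (cases a) (simp_all add: power2_eq_square)
  from this[of "2 ^ lg l"] have "par_N l = (2 ^ lg l - 1) * par_m l"
    by (simp add: par_N_def par_q_def par_m_def mult.commute flip: power_mult)
  moreover have "0 < par_m l" by (simp add: par_m_def)
  ultimately show "par_n l = 2 ^ lg l - 1" "par_m l dvd par_N l"
    by (simp_all add: par_n_def)
qed

text \<open>The bias is \<open>p = (1/2) ^ par_d l\<close>.\<close>

definition par_d :: "nat \<Rightarrow> nat" where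
  "par_d l = (THE d. 1 / (80 * sqrt (real (par_n l))) < (1 / 2) ^ d \<and>
                     (1 / 2) ^ d \<le> 1 / (40 * sqrt (real (par_n l))))"

lemma par_d_unique:
  assumes "0 < par_n l"
  shows "\<exists>!d. 1 / (80 * sqrt (real (par_n l))) < (1 / 2) ^ d \<and>
              (1 / 2) ^ d \<le> 1 / (40 * sqrt (real (par_n l)))"
proof -
  define a :: real where "a = 1 / (80 * sqrt (real (par_n l)))"
  have two_a: "1 / (40 * sqrt (real (par_n l))) = 2 * a" by (simp add: a_def)
  have sqrt1: "1 \<le> sqrt (real (par_n l))" using assms by simp
  then have "1 < 40 * sqrt (real (par_n l))" by linarith
  then have a: "0 < a" "2 * a < 1" using assms by (simp_all add: a_def divide_less_eq)
  have half: "(1 / 2 :: real) ^ e \<le> (1 / 2) ^ d" if "d \<le> e" for d e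
    using that by (intro power_decreasing) auto
  have "\<exists>d. (1 / 2 :: real) ^ d < 2 * a"
    using a(1) by (intro real_arch_pow_inv) auto
  then have ex: "\<exists>d. (1 / 2 :: real) ^ d \<le> 2 * a" by (auto intro: less_imp_le)
  define d where "d = (LEAST d. (1 / 2 :: real) ^ d \<le> 2 * a)"
  have d: "(1 / 2 :: real) ^ d \<le> 2 * a"
    unfolding d_def using ex by (rule LeastI_ex)
  obtain d' where d': "d = Suc d'" using d a(2) by (cases d) auto
  have "2 * a < (1 / 2 :: real) ^ d'"
    using not_less_Least[of d' "\<lambda>d. (1 / 2 :: real) ^ d \<le> 2 * a"] d' unfolding d_def by auto
  then have "a < (1 / 2) ^ d" by (simp add: d')
  moreover have "e = f" if "a < (1 / 2) ^ e" "(1 / 2) ^ e \<le> 2 * a"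
      "a < (1 / 2) ^ f" "(1 / 2) ^ f \<le> 2 * a" for e f :: nat
    using that half[of "Suc e" f] half[of "Suc f" e] by (cases e f rule: linorder_cases) auto
  ultimately show ?thesis using d unfolding two_a a_def[symmetric] by blast
qed

definition is_generator :: "'a ring \<Rightarrow> 'a \<Rightarrow> bool" where
  "is_generator K g \<longleftrightarrow> g \<in> carrier (mult_of K) \<and>
     carrier (mult_of K) = {g [^]\<^bsub>mult_of K\<^esub> i | i :: nat. i \<in> UNIV}"

text \<open>Vectors over the alphabet \<open>\<Sigma> = K^m\<close> are lists (of length \<open>n\<close>) of lists (of length \<open>m\<close>).\<close>

definition alphabet :: "'a ring \<Rightarrow> nat \<Rightarrow> 'a list set" where
  "alphabet K l = {x. length x = par_m l \<and> set x \<subseteq> carrier K}"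

definition codeword :: "'a ring \<Rightarrow> 'a \<Rightarrow> nat \<Rightarrow> 'a list \<Rightarrow> 'a list list" where
  "codeword K g l f =
     map (\<lambda>j. map (\<lambda>i. ring.eval K f (g [^]\<^bsub>K\<^esub> (j * par_m l + i))) [1..<par_m l + 1]) [0..<par_n l]"

definition frs_code :: "'a ring \<Rightarrow> 'a \<Rightarrow> nat \<Rightarrow> 'a list list set" where
  "frs_code K g l =
     codeword K g l ` {f \<in> carrier (univ_poly K (carrier K)). Polynomials.degree f \<le> par_k l}"

text \<open>An oracle assigns to every bitstring an infinite sequence of output bits; a query with
  desired output length \<open>len\<close> returns the first \<open>len\<close> of them.\<close>

type_synonym oracle_fun = "bool list \<times> nat \<Rightarrow> bool"

definition answer :: "oracle_fun \<Rightarrow> bool list \<Rightarrow> nat \<Rightarrow> bool list" where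
  "answer F x len = map (\<lambda>i. F (x, i)) [0..<len]"

definition random_oracle :: "oracle_fun measure" where
  "random_oracle = PiM UNIV (\<lambda>_. measure_pmf (pmf_of_set (UNIV :: bool set)))"

lemma space_random_oracle [simp]: "space random_oracle = UNIV"
  by (simp add: random_oracle_def space_PiM)

lemma prob_space_random_oracle: "prob_space random_oracle"
  unfolding random_oracle_def by (intro prob_space_PiM measure_pmf.prob_space_axioms)

lemma finitely_determined_event:
  assumes "finite S" and P: "\<And>F F'. (\<And>s. s \<in> S \<Longrightarrow> F s = F' s) \<Longrightarrow> P F = P F'"
  shows "{F \<in> space random_oracle. P F} \<in> sets random_oracle"
proof -
  have [measurable]: "(\<lambda>F. F s) \<in> measurable random_oracle (count_space UNIV)" for s
    unfolding random_oracle_def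
    by (rule measurable_compose[OF measurable_component_singleton]) auto
  have "{F \<in> space random_oracle. P F} =
      (\<Union>T\<in>{T \<in> Pow S. P (\<lambda>s. s \<in> T)}. {F \<in> space random_oracle. \<forall>s\<in>S. F s = (s \<in> T)})"
    (is "?l = ?r")
  proof (intro equalityI subsetI)
    fix F assume F: "F \<in> ?l"
    have "P F = P (\<lambda>s. s \<in> {s \<in> S. F s})" by (rule P) auto
    then show "F \<in> ?r" using F by (intro UN_I[of "{s \<in> S. F s}"]) auto
  next
    fix F assume "F \<in> ?r"
    then obtain T where "P (\<lambda>s. s \<in> T)" "\<forall>s\<in>S. F s = (s \<in> T)" by auto
    then show "F \<in> ?l" using P[of F "\<lambda>s. s \<in> T"] by auto
  qed
  also have "\<dots> \<in> sets random_oracle"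
  proof (rule sets.finite_UN)
    show "finite {T \<in> Pow S. P (\<lambda>s. s \<in> T)}" using assms(1) by simp
    show "{F \<in> space random_oracle. \<forall>s\<in>S. F s = (s \<in> T)} \<in> sets random_oracle" for T
    proof (rule sets.sets_Collect_finite_All[OF _ assms(1)])
      show "{F \<in> space random_oracle. F s = (s \<in> T)} \<in> sets random_oracle" for s
        by measurable
    qed
  qed
  finally show ?thesis .
qed

definition biased_oracle ::
  "(nat \<times> 'a list \<Rightarrow> bool list) \<Rightarrow> nat \<Rightarrow> oracle_fun \<Rightarrow> nat \<Rightarrow> 'a list \<Rightarrow> bool" where
  "biased_oracle enc l F i x \<longleftrightarrow> answer F (enc (i, x)) (par_d l) = replicate (par_d l) True"

text \<open>\<open>None\<close> stands for \<open>\<bottom>\<close>. The arguments after the oracle are \<open>\<lambda>\<close>, \<open>h\<^sub>\<infinity>\<close> and the proof.\<close>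

type_synonym 'p verifier = "oracle_fun \<Rightarrow> nat \<Rightarrow> nat \<Rightarrow> 'p option \<Rightarrow> 'p option"

text \<open>Coordinates are numbered \<open>1, \<dots>, n\<close>, so that \<open>x\<^sub>i\<close> is \<open>xs ! (i - 1)\<close>.\<close>

definition frs_verify ::
  "(nat \<Rightarrow> 'a ring) \<Rightarrow> (nat \<Rightarrow> 'a) \<Rightarrow> (nat \<Rightarrow> nat \<times> 'a list \<Rightarrow> bool list) \<Rightarrow> 'a list list verifier" where
  "frs_verify K g enc F l h pf =
     (case pf of
        None \<Rightarrow> None
      | Some xs \<Rightarrow>
          if xs \<in> frs_code (K l) (g l) l \<and>
             (\<forall>i\<in>{1..par_n l}. \<not> biased_oracle (enc l) l F i (xs ! (i - 1)))
          then Some xs else None)"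

text \<open>A basis state \<open>(x, y, w)\<close> consists of a query register \<open>x\<close>, a response register \<open>y\<close>, whose
  length is the desired output length, and a work register \<open>w\<close>. A query maps \<open>(x, y, w)\<close> to
  \<open>(x, y \<oplus> F(x), w)\<close>. The bounds \<open>in_len\<close>, \<open>out_len\<close> and \<open>work_dim\<close> are arbitrary; they make
  the state space of each individual algorithm finite-dimensional.\<close>

type_synonym label = "bool list \<times> bool list \<times> nat"

type_synonym state = "label \<Rightarrow> complex"

record 'p query_algorithm =
  in_len :: nat
  out_len :: nat
  work_dim :: nat
  num_queries :: nat
  unitary :: "nat \<Rightarrow> label \<Rightarrow> label \<Rightarrow> complex"
  readout :: "label \<Rightarrow> 'p option"

definition labels :: "'p query_algorithm \<Rightarrow> label set" where
  "labels A = {x. length x \<le> in_len A} \<times> {y. length y \<le> out_len A} \<times> {..<work_dim A}"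

definition unitary_on :: "label set \<Rightarrow> (label \<Rightarrow> label \<Rightarrow> complex) \<Rightarrow> bool" where
  "unitary_on L U \<longleftrightarrow>
     (\<forall>a\<in>L. \<forall>b\<in>L. (\<Sum>c\<in>L. cnj (U c a) * U c b) = (if a = b then 1 else 0))"

definition valid_algorithm :: "'p query_algorithm \<Rightarrow> bool" where
  "valid_algorithm A \<longleftrightarrow>
     0 < work_dim A \<and> (\<forall>t\<le>num_queries A. unitary_on (labels A) (unitary A t))"

definition apply_op :: "label set \<Rightarrow> (label \<Rightarrow> label \<Rightarrow> complex) \<Rightarrow> state \<Rightarrow> state" where
  "apply_op L U \<psi> = (\<lambda>a. \<Sum>b\<in>L. U a b * \<psi> b)"

text \<open>Since adding \<open>F(x)\<close> bitwise is an involution, the amplitude of \<open>(x, y, w)\<close> after a query is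
  the previous amplitude of \<open>(x, y \<oplus> F(x), w)\<close>.\<close>

definition query_op :: "oracle_fun \<Rightarrow> state \<Rightarrow> state" where
  "query_op F \<psi> = (\<lambda>(x, y, w). \<psi> (x, map2 (\<noteq>) y (answer F x (length y)), w))"

primrec state_after :: "'p query_algorithm \<Rightarrow> oracle_fun \<Rightarrow> nat \<Rightarrow> state" where
  "state_after A F 0 =
     apply_op (labels A) (unitary A 0) (\<lambda>a. if a = ([], [], 0) then 1 else 0)"
| "state_after A F (Suc t) =
     apply_op (labels A) (unitary A (Suc t)) (query_op F (state_after A F t))"

definition measurement_pmf :: "'p query_algorithm \<Rightarrow> oracle_fun \<Rightarrow> label pmf" where
  "measurement_pmf A F =
     embed_pmf (\<lambda>a. if a \<in> labels A then (cmod (state_after A F (num_queries A) a))\<^sup>2 else 0)"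

definition output_pmf :: "'p query_algorithm \<Rightarrow> oracle_fun \<Rightarrow> 'p option pmf" where
  "output_pmf A F = map_pmf (readout A) (measurement_pmf A F)"

lemma finite_labels [simp]: "finite (labels A)"
proof -
  have "finite {x :: bool list. length x \<le> r}" for r
    using finite_lists_length_le[of "UNIV :: bool set" r] by simp
  then show ?thesis by (simp add: labels_def)
qed

lemma apply_op_norm:
  assumes "finite L" "unitary_on L U"
  shows "(\<Sum>a\<in>L. (cmod (apply_op L U \<psi> a))\<^sup>2) = (\<Sum>a\<in>L. (cmod (\<psi> a))\<^sup>2)"
proof -
  have "complex_of_real ((cmod (\<Sum>b\<in>L. U c b * \<psi> b))\<^sup>2)
      = (\<Sum>a\<in>L. \<Sum>b\<in>L. (cnj (U c a) * U c b) * (cnj (\<psi> a) * \<psi> b))" for c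
    unfolding complex_norm_square
    by (simp add: sum_product mult_ac) (rule sum.swap)
  then have "complex_of_real (\<Sum>a\<in>L. (cmod (apply_op L U \<psi> a))\<^sup>2)
      = (\<Sum>c\<in>L. \<Sum>a\<in>L. \<Sum>b\<in>L. (cnj (U c a) * U c b) * (cnj (\<psi> a) * \<psi> b))"
    by (simp add: apply_op_def)
  also have "\<dots> = (\<Sum>a\<in>L. \<Sum>c\<in>L. \<Sum>b\<in>L. (cnj (U c a) * U c b) * (cnj (\<psi> a) * \<psi> b))"
    by (rule sum.swap)
  also have "\<dots> = (\<Sum>a\<in>L. \<Sum>b\<in>L. (\<Sum>c\<in>L. cnj (U c a) * U c b) * (cnj (\<psi> a) * \<psi> b))"
    by (rule sum.cong[OF refl], subst sum.swap) (simp add: sum_distrib_right)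
  also have "\<dots> = (\<Sum>a\<in>L. \<Sum>b\<in>L. if a = b then cnj (\<psi> a) * \<psi> b else 0)"
    using assms(2) by (intro sum.cong refl) (auto simp: unitary_on_def)
  also have "\<dots> = complex_of_real (\<Sum>a\<in>L. (cmod (\<psi> a))\<^sup>2)"
    unfolding of_real_sum complex_norm_square
    using assms(1) by (intro sum.cong refl) (simp add: mult.commute)
  finally show ?thesis by (simp only: of_real_eq_iff)
qed

lemma map2_xor_invol:
  "length y = length z \<Longrightarrow> map2 (\<lambda>a b. a = (\<not> b)) (map2 (\<lambda>a b. a = (\<not> b)) y z) z = y"
  by (induction y z rule: list_induct2) auto

lemma query_op_norm:
  "(\<Sum>a\<in>labels A. (cmod (query_op F \<psi> a))\<^sup>2) = (\<Sum>a\<in>labels A. (cmod (\<psi> a))\<^sup>2)"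
proof -
  define f :: "label \<Rightarrow> label" where
    "f = (\<lambda>(x, y, w). (x, map2 (\<noteq>) y (answer F x (length y)), w))"
  have len: "length (answer F x k) = k" for x k by (simp add: answer_def)
  have "f (f a) = a" for a
    by (cases a) (simp add: f_def len map2_xor_invol)
  moreover have "f a \<in> labels A" if "a \<in> labels A" for a
    using that by (auto simp: f_def labels_def len)
  ultimately have "bij_betw f (labels A) (labels A)"
    by (intro bij_betw_byWitness[where f' = f]) auto
  then have "(\<Sum>a\<in>labels A. (cmod (\<psi> (f a)))\<^sup>2) = (\<Sum>a\<in>labels A. (cmod (\<psi> a))\<^sup>2)"
    by (rule sum.reindex_bij_betw)
  then show ?thesis by (simp add: f_def query_op_def case_prod_unfold)
qed

lemma state_after_norm:
  assumes "valid_algorithm A" "t \<le> num_queries A"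
  shows "(\<Sum>a\<in>labels A. (cmod (state_after A F t a))\<^sup>2) = 1"
  using assms(2)
proof (induction t)
  case 0
  have "([], [], 0) \<in> labels A"
    using assms(1) by (simp add: labels_def valid_algorithm_def)
  then have "(\<Sum>a\<in>labels A. (cmod (if a = ([], [], 0) then 1 else 0))\<^sup>2) = (1 :: real)"
    by (simp add: if_distrib[of cmod] if_distrib[of "\<lambda>x. x\<^sup>2"] cong: if_cong)
  with 0 assms(1) show ?case
    by (simp add: apply_op_norm valid_algorithm_def)
next
  case (Suc t)
  with assms(1) show ?case
    by (simp add: apply_op_norm valid_algorithm_def query_op_norm)
qed

lemma pmf_measurement_pmf:
  assumes "valid_algorithm A"
  shows "pmf (measurement_pmf A F) a =
    (if a \<in> labels A then (cmod (state_after A F (num_queries A) a))\<^sup>2 else 0)"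
  unfolding measurement_pmf_def
proof (rule pmf_embed_pmf)
  let ?f = "\<lambda>a. if a \<in> labels A then (cmod (state_after A F (num_queries A) a))\<^sup>2 else 0"
  have "(\<integral>\<^sup>+a. ennreal (?f a) \<partial>count_space UNIV) = (\<Sum>a\<in>labels A. ennreal (?f a))"
    by (rule nn_integral_count_space'[OF finite_labels]) auto
  also have "\<dots> = ennreal (\<Sum>a\<in>labels A. ?f a)"
    by (rule sum_ennreal) simp
  also have "(\<Sum>a\<in>labels A. ?f a) = 1"
    using state_after_norm[OF assms order_refl] by simp
  finally show "(\<integral>\<^sup>+a. ennreal (?f a) \<partial>count_space UNIV) = 1" by simp
qed simp

definition negligible :: "(nat \<Rightarrow> real) \<Rightarrow> bool" where
  "negligible \<nu> \<longleftrightarrow> (\<forall>e :: nat. eventually (\<lambda>l. \<bar>\<nu> l\<bar> \<le> 1 / real l ^ e) sequentially)"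

definition min_entropy :: "'b pmf \<Rightarrow> real" where
  "min_entropy D = - log 2 (SUP z. pmf D z)"

definition verified_pmf ::
  "'p verifier \<Rightarrow> oracle_fun \<Rightarrow> nat \<Rightarrow> nat \<Rightarrow> 'p query_algorithm \<Rightarrow> 'p option pmf" where
  "verified_pmf V F l h A = map_pmf (V F l h) (output_pmf A F)"

definition accept_prob ::
  "'p verifier \<Rightarrow> oracle_fun \<Rightarrow> nat \<Rightarrow> nat \<Rightarrow> 'p query_algorithm \<Rightarrow> real" where
  "accept_prob V F l h A = measure_pmf.prob (verified_pmf V F l h A) {z. z \<noteq> None}"

text \<open>This is meaningful only if the acceptance probability is positive.\<close>

definition accepted_pmf ::
  "'p verifier \<Rightarrow> oracle_fun \<Rightarrow> nat \<Rightarrow> nat \<Rightarrow> 'p query_algorithm \<Rightarrow> 'p option pmf" where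
  "accepted_pmf V F l h A = cond_pmf (verified_pmf V F l h A) {z. z \<noteq> None}"

lemma state_after_cong:
  assumes "\<And>x i. length x \<le> in_len A \<Longrightarrow> i < out_len A \<Longrightarrow> F (x, i) = F' (x, i)"
  shows "state_after A F t = state_after A F' t"
proof (induction t)
  case (Suc t)
  have "query_op F \<psi> a = query_op F' \<psi> a" if a: "a \<in> labels A" for \<psi> a
  proof -
    obtain x y w where xyw: "a = (x, y, w)" by (cases a)
    then have "answer F x (length y) = answer F' x (length y)"
      using a assms by (auto simp: answer_def labels_def)
    then show ?thesis by (simp add: query_op_def xyw)
  qed
  with Suc show ?case by (simp add: apply_op_def)
qed simp

lemma frs_verify_cong:
  assumes "\<And>xs i j. pf = Some xs \<Longrightarrow> i \<in> {1..par_n l} \<Longrightarrow> j < par_d l \<Longrightarrow>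
      F (enc l (i, xs ! (i - 1)), j) = F' (enc l (i, xs ! (i - 1)), j)"
  shows "frs_verify K g enc F l h pf = frs_verify K g enc F' l h pf"
proof (cases pf)
  case (Some xs)
  have "answer F (enc l (i, xs ! (i - 1))) (par_d l) = answer F' (enc l (i, xs ! (i - 1))) (par_d l)"
    if "i \<in> {1..par_n l}" for i
    using assms[OF Some that] by (simp add: answer_def)
  then show ?thesis by (simp add: frs_verify_def Some biased_oracle_def)
qed (simp add: frs_verify_def)

text \<open>The event that the definition of certifiable min-entropy refers to is measurable, because it
  depends on finitely many bits of the random oracle.\<close>

lemma low_entropy_event_measurable:
  fixes A :: "'a list list query_algorithm"
    and K :: "nat \<Rightarrow> 'a ring" and g :: "nat \<Rightarrow> 'a" and enc :: "nat \<Rightarrow> nat \<times> 'a list \<Rightarrow> bool list"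
  assumes "valid_algorithm A"
  defines "V \<equiv> frs_verify K g enc"
  shows "{F \<in> space random_oracle.
      accept_prob V F l h A \<ge> \<delta> \<and> min_entropy (accepted_pmf V F l h A) \<le> b}
    \<in> sets random_oracle"
proof -
  define S1 where "S1 = {x :: bool list. length x \<le> in_len A} \<times> {..<out_len A}"
  define S2 where "S2 = (\<lambda>((a, i), j). (enc l (i, the (readout A a) ! (i - 1)), j)) `
    ((labels A \<times> {1..par_n l}) \<times> {..<par_d l})"
  have "finite {x :: bool list. length x \<le> in_len A}"
    using finite_lists_length_le[of "UNIV :: bool set" "in_len A"] by simp
  then have fin: "finite (S1 \<union> S2)" by (simp add: S1_def S2_def)
  have *: "verified_pmf V F l h A = verified_pmf V F' l h A"
    if F: "\<And>s. s \<in> S1 \<union> S2 \<Longrightarrow> F s = F' s" for F F'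
  proof -
    have "state_after A F (num_queries A) = state_after A F' (num_queries A)"
      using F by (intro state_after_cong) (auto simp: S1_def)
    then have m: "measurement_pmf A F = measurement_pmf A F'"
      by (simp add: measurement_pmf_def cong: if_cong)
    have "V F l h (readout A a) = V F' l h (readout A a)"
      if "a \<in> set_pmf (measurement_pmf A F')" for a
    proof -
      have a: "a \<in> labels A"
        using that assms(1) by (auto simp: set_pmf_iff pmf_measurement_pmf split: if_splits)
      show ?thesis unfolding V_def
      proof (rule frs_verify_cong)
        fix xs i j assume "readout A a = Some xs" "i \<in> {1..par_n l}" "j < par_d l"
        then have "(enc l (i, xs ! (i - 1)), j) \<in> S2"
          using a unfolding S2_def by (intro image_eqI[of _ _ "((a, i), j)"]) auto
        then show "F (enc l (i, xs ! (i - 1)), j) = F' (enc l (i, xs ! (i - 1)), j)"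
          using F by blast
      qed
    qed
    then show ?thesis
      unfolding verified_pmf_def output_pmf_def m pmf.map_comp
      by (intro map_pmf_cong refl) simp
  qed
  show ?thesis
  proof (rule finitely_determined_event[OF fin])
    fix F F' :: oracle_fun assume F: "\<And>s. s \<in> S1 \<union> S2 \<Longrightarrow> F s = F' s"
    have "verified_pmf V F l h A = verified_pmf V F' l h A" by (rule *) (rule F)
    then show "(\<delta> \<le> accept_prob V F l h A \<and> min_entropy (accepted_pmf V F l h A) \<le> b) =
        (\<delta> \<le> accept_prob V F' l h A \<and> min_entropy (accepted_pmf V F' l h A) \<le> b)"
      by (simp only: accept_prob_def accepted_pmf_def)
  qed
qed

text \<open>An adversary is an arbitrary (non-uniform) family of query algorithms indexed by the inputs
  \<open>1^\<lambda>\<close> and \<open>1^h\<close>.\<close>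

definition certifiable_min_entropy ::
  "'p verifier \<Rightarrow> (nat \<Rightarrow> real) \<Rightarrow> (nat \<Rightarrow> nat) \<Rightarrow> bool" where
  "certifiable_min_entropy V Q h \<longleftrightarrow>
     (\<forall>B :: nat \<Rightarrow> nat \<Rightarrow> 'p query_algorithm.
        (\<forall>l. valid_algorithm (B l (h l)) \<and> real (num_queries (B l (h l))) \<le> Q l) \<longrightarrow>
        (\<forall>e :: nat. \<exists>\<nu>. negligible \<nu> \<and>
           (\<forall>l. \<P>(F in random_oracle.
                  accept_prob V F l (h l) (B l (h l)) \<ge> 1 / real l ^ e \<and>
                  min_entropy (accepted_pmf V F l (h l) (B l (h l))) \<le> real (h l)) \<le> \<nu> l)))"

end

theory Submission
  imports
    Defs
    "HOL-Algebra.Algebraic_Closure_Type"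
    "HOL-Library.Z2"
    "HOL-Real_Asymp.Real_Asymp"
begin

text \<open>
  If the output is accepted with probability \<open>\<delta>\<close> and has min-entropy at most \<open>h\<close>, then some valid
  codeword \<open>x\<close> is output with probability at least \<open>\<epsilon> = \<delta> / 2 ^ h\<close>. Fix \<open>x\<close> and condition on \<open>x\<close> being
  valid, which has probability \<open>(1 - p) ^ n\<close>. Setting \<open>H\<close> to 1 at \<open>(i, x\<^sub>i)\<close> for a \<open>p\<close>-random set \<open>D\<close> of
  coordinates turns the conditioned oracle back into a uniform one. Either \<open>x\<close> is still output with
  probability \<open>\<epsilon> / 4\<close> for half of the sets \<open>D\<close>; or, by the hybrid argument, \<open>D\<close> usually contains a
  coordinate carrying non-negligible query weight. In the second case, reprogramming one point changes
  the query weight on that point by at most a factor \<open>4 Q\<^sup>2\<close>, so membership of \<open>i\<close> in \<open>D\<close> is almost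
  independent of \<open>i\<close> being heavy; as every coordinate lies in \<open>D\<close> only with probability \<open>p\<close>, on average
  order \<open>1 / p\<close> coordinates of \<open>x\<close> are heavy. For a uniform oracle the first alternative holds for at
  most \<open>4 / \<epsilon>\<close> codewords, and the second for at most \<open>q ^ s\<close> of them with \<open>s\<close> slightly above
  \<open>\<lambda> powr c\<close>, because the folded Reed-Solomon code is list-recoverable. Hence the event has
  probability at most \<open>n (1 - p) ^ n (4 / \<epsilon> + q ^ s)\<close>, where \<open>(1 - p) ^ n\<close> is exponentially small in
  \<open>sqrt \<lambda>\<close>.
\<close>

section \<open>List recovery by interpolation\<close>

text \<open>Give an exponent tuple e the weight 2^(r - sum of e). It is at least 1 on the counted
  tuples, and its total over the box factors into s geometric series, each at most 2.\<close>

lemma card_box_weight_less: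
  "card {e \<in> {..<s} \<rightarrow>\<^sub>E {..<b :: nat}. (\<Sum>i<s. e i) < r} \<le> 2 ^ (s + r)"
proof -
  let ?B = "{..<s} \<rightarrow>\<^sub>E {..<b}"
  let ?W = "{e \<in> ?B. (\<Sum>i<s. e i) < r}"
  have fin: "finite ?B" by (intro finite_PiE) auto
  have geo: "(\<Sum>j<b. (1 / 2 :: real) ^ j) \<le> 2"
    by (simp add: geometric_sum)
  have "real (card ?W) = (\<Sum>e\<in>?W. 1)" by simp
  also have "\<dots> \<le> (\<Sum>e\<in>?W. 2 ^ r * (\<Prod>i<s. (1 / 2) ^ e i))"
  proof (rule sum_mono)
    fix e assume "e \<in> ?W"
    then have "(1 / 2 :: real) ^ r \<le> (1 / 2) ^ (\<Sum>i<s. e i)"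
      by (intro power_decreasing) auto
    then have "2 ^ r * (1 / 2 :: real) ^ r \<le> 2 ^ r * (1 / 2) ^ (\<Sum>i<s. e i)"
      by (intro mult_left_mono) auto
    then show "1 \<le> 2 ^ r * (\<Prod>i<s. (1 / 2 :: real) ^ e i)"
      by (simp add: power_sum power_divide)
  qed
  also have "\<dots> \<le> (\<Sum>e\<in>?B. 2 ^ r * (\<Prod>i<s. (1 / 2) ^ e i))"
    using fin by (intro sum_mono2 mult_nonneg_nonneg prod_nonneg) auto
  also have "\<dots> = 2 ^ r * (\<Prod>i<s. \<Sum>j<b. (1 / 2) ^ j)"
    by (simp only: prod_sum_PiE finite_lessThan sum_distrib_left)
  also have "\<dots> \<le> 2 ^ r * (\<Prod>i<s. 2)"
    by (intro mult_left_mono prod_mono conjI geo sum_nonneg) simp_all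
  also have "\<dots> = real (2 ^ (s + r))" by (simp add: power_add mult.commute)
  finally show ?thesis by (simp only: of_nat_le_iff)
qed

text \<open>Pigeonhole: the system maps K^E to K^J, both finite and the first one larger, so two
  vectors collide and their difference is a solution. Closure of K under sums and products keeps the
  image inside K^J.\<close>

lemma exists_nontrivial_solution:
  fixes a :: "'j \<Rightarrow> 'e \<Rightarrow> 'a :: comm_ring" and K :: "'a set"
  assumes K: "finite K" "2 \<le> card K" "\<And>x y. x \<in> K \<Longrightarrow> y \<in> K \<Longrightarrow> x + y \<in> K"
    "\<And>x y. x \<in> K \<Longrightarrow> y \<in> K \<Longrightarrow> x * y \<in> K" "0 \<in> K"
  assumes fin: "finite J" "finite E" and less: "card J < card E"
    and a: "\<And>j e. j \<in> J \<Longrightarrow> e \<in> E \<Longrightarrow> a j e \<in> K"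
  shows "\<exists>c. (\<exists>e\<in>E. c e \<noteq> 0) \<and> (\<forall>j\<in>J. (\<Sum>e\<in>E. c e * a j e) = 0)"
proof -
  define T where "T = (\<lambda>c. \<lambda>j\<in>J. \<Sum>e\<in>E. c e * a j e)"
  have sumK: "(\<Sum>e\<in>Z. f e) \<in> K" if "\<And>e. e \<in> Z \<Longrightarrow> f e \<in> K" for Z and f :: "'e \<Rightarrow> 'a"
    using that K(3,5) by (induction Z rule: infinite_finite_induct) auto
  have "T ` (E \<rightarrow>\<^sub>E K) \<subseteq> J \<rightarrow>\<^sub>E K"
  proof (intro image_subsetI)
    fix c assume c: "c \<in> E \<rightarrow>\<^sub>E K"
    have "(\<Sum>e\<in>E. c e * a j e) \<in> K" if "j \<in> J" for j
      using that c a by (intro sumK K(4)) auto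
    then show "T c \<in> J \<rightarrow>\<^sub>E K" by (simp add: T_def)
  qed
  moreover have "card (J \<rightarrow>\<^sub>E K) < card (E \<rightarrow>\<^sub>E K)"
    using fin less K(2) by (simp add: card_PiE)
  moreover have "finite (J \<rightarrow>\<^sub>E K)" "finite (E \<rightarrow>\<^sub>E K)" using fin K(1) by (simp_all add: finite_PiE)
  ultimately have "\<not> inj_on T (E \<rightarrow>\<^sub>E K)"
    using card_inj_on_le[of T "E \<rightarrow>\<^sub>E K" "J \<rightarrow>\<^sub>E K"] by auto
  then obtain c c' where c: "c \<in> E \<rightarrow>\<^sub>E K" "c' \<in> E \<rightarrow>\<^sub>E K" "c \<noteq> c'" "T c = T c'"
    by (auto simp: inj_on_def)
  show ?thesis
  proof (intro exI[of _ "\<lambda>e. c e - c' e"] conjI ballI)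
    show "\<exists>e\<in>E. c e - c' e \<noteq> 0" using c(1-3) by (metis PiE_ext right_minus_eq)
    show "(\<Sum>e\<in>E. (c e - c' e) * a j e) = 0" if "j \<in> J" for j
      using fun_cong[OF c(4), of j] that by (simp add: T_def algebra_simps sum_subtractf)
  qed
qed

section \<open>Base-q numerals, Frobenius, Taylor expansion and root counting\<close>

lemma base_sum_less:
  assumes "\<And>i. i < s \<Longrightarrow> e i < q"
  shows "(\<Sum>i<s. e i * q ^ i) < (q :: nat) ^ s"
  using assms
proof (induction s)
  case (Suc s)
  have "(\<Sum>i<Suc s. e i * q ^ i) < q ^ s + e s * q ^ s" using Suc by simp
  also have "\<dots> = (e s + 1) * q ^ s" by simp
  also have "\<dots> \<le> q * q ^ s" using Suc.prems[of s] by (intro mult_right_mono) auto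
  finally show ?case by simp
qed simp

lemma base_sum_inj:
  assumes "\<And>i. i < s \<Longrightarrow> e i < q" "\<And>i. i < s \<Longrightarrow> e' i < (q :: nat)"
    and "(\<Sum>i<s. e i * q ^ i) = (\<Sum>i<s. e' i * q ^ i)" and "i < s"
  shows "e i = e' i"
  using assms
proof (induction s arbitrary: i)
  case (Suc s)
  have less: "(\<Sum>i<s. e i * q ^ i) < q ^ s" "(\<Sum>i<s. e' i * q ^ i) < q ^ s"
    using Suc.prems by (auto intro!: base_sum_less)
  have eq: "(\<Sum>i<s. e i * q ^ i) + e s * q ^ s = (\<Sum>i<s. e' i * q ^ i) + e' s * q ^ s"
    using Suc.prems(3) by simp
  have "(l + a * q ^ s) div q ^ s = a" if "l < q ^ s" for l a
    using that by (intro div_nat_eqI) (auto simp: mult.commute)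
  then have es: "e s = e' s"
    using arg_cong[OF eq, of "\<lambda>x. x div q ^ s"] less by metis
  show ?case
  proof (cases "i = s")
    case False
    show ?thesis
      by (rule Suc.IH) (use Suc.prems False es eq in auto)
  qed (use es in simp)
qed simp

text \<open>The q-th power map is additive and multiplicative and fixes the coefficients, so it
  passes through the evaluation to the point z.\<close>

lemma poly_power_of_fixed_coeffs:
  fixes f :: "'a :: field poly"
  assumes frob: "\<And>x y :: 'a. (x + y) ^ q = x ^ q + y ^ q" and "0 < q"
    and "\<And>i. Polynomial.coeff f i ^ q = Polynomial.coeff f i"
  shows "poly f z ^ q = poly f (z ^ q)"
  using assms(3)
proof (induction f)
  case (pCons a f)
  have "poly f z ^ q = poly f (z ^ q)"
    using pCons.prems[of "Suc _"] by (intro pCons.IH) simp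
  moreover have "a ^ q = a" using pCons.prems[of 0] by simp
  ultimately show ?case by (simp add: frob power_mult_distrib)
qed (use assms(2) in simp)

text \<open>The binomial theorem expands each Y_i around y_i. The inner index may run over the whole
  box because binomial coefficients with too large a lower index vanish. The Taylor coefficients
  found here become the linear constraints for vanishing to high order at y.\<close>

lemma sum_prod_taylor:
  fixes Y y :: "nat \<Rightarrow> 'a :: comm_ring_1"
  assumes "\<And>i. i < s \<Longrightarrow> e i < b"
  shows "(\<Prod>i<s. Y i ^ e i) = (\<Sum>e'\<in>{..<s} \<rightarrow>\<^sub>E {..<b :: nat}.
    (\<Prod>i<s. of_nat (e i choose e' i) * y i ^ (e i - e' i)) * (\<Prod>i<s. (Y i - y i) ^ e' i))"
proof -
  have "Y i ^ e i = (\<Sum>j<b. of_nat (e i choose j) * y i ^ (e i - j) * (Y i - y i) ^ j)"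
    if "i < s" for i
  proof -
    have "Y i ^ e i = ((Y i - y i) + y i) ^ e i" by simp
    also have "\<dots> = (\<Sum>j\<le>e i. of_nat (e i choose j) * y i ^ (e i - j) * (Y i - y i) ^ j)"
      unfolding binomial_ring by (simp add: mult_ac)
    also have "\<dots> = (\<Sum>j<b. of_nat (e i choose j) * y i ^ (e i - j) * (Y i - y i) ^ j)"
      using assms[OF that] by (intro sum.mono_neutral_left) (auto simp: not_le binomial_eq_0)
    finally show ?thesis .
  qed
  then have "(\<Prod>i<s. Y i ^ e i) =
      (\<Prod>i<s. \<Sum>j<b. of_nat (e i choose j) * y i ^ (e i - j) * (Y i - y i) ^ j)" by simp
  also have "\<dots> = (\<Sum>e'\<in>{..<s} \<rightarrow>\<^sub>E {..<b}.
      \<Prod>i<s. of_nat (e i choose e' i) * y i ^ (e i - e' i) * (Y i - y i) ^ e' i)"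
    by (rule prod_sum_PiE) auto
  finally show ?thesis by (simp add: prod.distrib)
qed

text \<open>Otherwise the roots in Z, counted with multiplicity, would exceed the degree.\<close>

lemma sum_order_ge_imp_zero:
  fixes R :: "'a :: field poly"
  assumes "\<And>x. x \<in> Z \<Longrightarrow> [:- x, 1:] ^ r dvd R" and "finite Z" and "Polynomial.degree R < r * card Z"
  shows "R = 0"
proof (rule ccontr)
  assume R: "R \<noteq> 0"
  have r: "0 < r" using assms(3) by (cases r) auto
  have ord: "r \<le> Polynomial.order x R" if x: "x \<in> Z" for x
    using assms(1)[OF x] R by (simp add: order_divides)
  then have Z: "Z \<subseteq> {x. poly R x = 0}"
    using r R order_root[of R] by (metis (mono_tags, lifting) mem_Collect_eq not_le subsetI)
  have "r * card Z = (\<Sum>x\<in>Z. r)" by simp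
  also have "\<dots> \<le> (\<Sum>x\<in>Z. Polynomial.order x R)" by (intro sum_mono ord)
  also have "\<dots> \<le> (\<Sum>x | poly R x = 0. Polynomial.order x R)"
    using Z R by (intro sum_mono2) (auto simp: poly_roots_finite)
  also have "\<dots> \<le> Polynomial.degree R" by (rule sum_order_le_degree[OF R])
  finally show False using assms(3) by simp
qed

text \<open>An extension of F_q described from inside: the q-power map is additive, \<gamma> plays
  the generator of F_q^*, and \<alpha> is a (q-1)-th root of \<gamma>, so that Frobenius acts on
  \<alpha> as multiplication by \<gamma>.\<close>

locale frobenius_field =
  fixes q :: nat and \<gamma> \<alpha> :: "'a :: field"
  assumes frob: "\<And>x y :: 'a. (x + y) ^ q = x ^ q + y ^ q"
    and q: "2 \<le> q"
    and gamma: "\<gamma> ^ q = \<gamma>" "inj_on (\<lambda>i. \<gamma> ^ i) {..<q - 1}" "\<gamma> \<noteq> 0"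
    and alpha: "\<alpha> ^ q = \<gamma> * \<alpha>" "\<alpha> \<noteq> 0"
begin

text \<open>The copy of F_q inside the extension.\<close>

definition "base = {x :: 'a. x ^ q = x}"

lemma base_closed:
  "0 \<in> base" "1 \<in> base" "x \<in> base \<Longrightarrow> y \<in> base \<Longrightarrow> x + y \<in> base"
  "x \<in> base \<Longrightarrow> y \<in> base \<Longrightarrow> x * y \<in> base" "x \<in> base \<Longrightarrow> y \<in> base \<Longrightarrow> x - y \<in> base"
  "x \<in> base \<Longrightarrow> x ^ j \<in> base" "of_nat j \<in> base"
proof -
  show 0: "0 \<in> base" "1 \<in> base" using q by (auto simp: base_def)
  show add: "x \<in> base \<Longrightarrow> y \<in> base \<Longrightarrow> x + y \<in> base" for x y by (simp add: base_def frob)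
  show mult: "x \<in> base \<Longrightarrow> y \<in> base \<Longrightarrow> x * y \<in> base" for x y by (simp add: base_def power_mult_distrib)
  show "x - y \<in> base" if "x \<in> base" "y \<in> base"
    using frob[of "x - y" y] that by (simp add: base_def eq_diff_eq)
  show "x \<in> base \<Longrightarrow> x ^ j \<in> base" by (induction j) (auto intro: 0 mult)
  show "of_nat j \<in> base" by (induction j) (auto intro: 0 add)
qed

lemma base_finite: "finite base" and card_base: "2 \<le> card base"
proof -
  have "base \<subseteq> {x. poly (Polynomial.monom 1 q - Polynomial.monom 1 1) x = 0}"
    by (auto simp: base_def poly_monom)
  moreover have "Polynomial.monom 1 q - Polynomial.monom 1 1 \<noteq> (0 :: 'a poly)"
    using q by (auto simp: Polynomial.monom_eq_iff')
  ultimately show "finite base" using poly_roots_finite finite_subset by blast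
  then show "2 \<le> card base"
    using card_mono[of base "{0, 1}"] base_closed(1,2) by simp
qed

lemma frob_iter: "\<alpha> ^ (q ^ i) = \<gamma> ^ i * \<alpha>"
proof (induction i)
  case (Suc i)
  have "(\<gamma> ^ i) ^ q = \<gamma> ^ i" using base_closed(6)[of \<gamma> i] gamma by (simp add: base_def)
  moreover have "\<alpha> ^ (q ^ Suc i) = (\<alpha> ^ (q ^ i)) ^ q" by (metis power_Suc2 power_mult)
  ultimately show ?case using Suc alpha by (simp add: power_mult_distrib)
qed simp

definition "base_polys k = {f :: 'a poly. Polynomial.degree f \<le> k \<and> (\<forall>i. Polynomial.coeff f i \<in> base)}"

text \<open>Frobenius moves the point \<alpha> and leaves the coefficients of f alone. Hence all
  shifted values f(\<gamma>^i \<alpha>) are powers of the single unknown f(\<alpha>).\<close>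

lemma poly_iter:
  assumes "f \<in> base_polys k"
  shows "poly f (\<gamma> ^ i * \<alpha>) = poly f \<alpha> ^ (q ^ i)"
proof -
  have *: "poly f z ^ q = poly f (z ^ q)" for z
    using assms q by (intro poly_power_of_fixed_coeffs frob) (auto simp: base_polys_def base_def)
  show ?thesis unfolding frob_iter[symmetric]
  proof (induction i)
    case (Suc i)
    have "poly f (\<alpha> ^ q ^ Suc i) = poly f ((\<alpha> ^ q ^ i) ^ q)" by (metis power_Suc2 power_mult)
    also have "\<dots> = (poly f \<alpha> ^ q ^ i) ^ q" by (simp only: *[symmetric] Suc)
    also have "\<dots> = poly f \<alpha> ^ q ^ Suc i" by (metis power_Suc2 power_mult)
    finally show ?case .
  qed simp
qed

text \<open>A difference vanishing at \<alpha> vanishes at the q - 1 distinct points \<gamma>^i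
  \<alpha>, more than its degree allows.\<close>

lemma inj_on_eval:
  assumes "k < q - 1"
  shows "inj_on (\<lambda>f. poly f \<alpha>) (base_polys k)"
proof (rule inj_onI)
  fix f f' assume f: "f \<in> base_polys k" "f' \<in> base_polys k" and eq: "poly f \<alpha> = poly f' \<alpha>"
  define h where "h = f - f'"
  have h: "h \<in> base_polys k"
    using f by (auto simp: h_def base_polys_def base_closed intro: degree_diff_le)
  define Z where "Z = (\<lambda>i. \<gamma> ^ i * \<alpha>) ` {..<q - 1}"
  have "h = 0"
  proof (rule sum_order_ge_imp_zero[of Z 1])
    show "[:- x, 1:] ^ 1 dvd h" if x: "x \<in> Z" for x
    proof -
      obtain i where i: "x = \<gamma> ^ i * \<alpha>" using x unfolding Z_def by blast
      then have "poly h x = poly h \<alpha> ^ q ^ i" using poly_iter[OF h] by simp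
      then have "poly h x = 0" using eq q by (simp add: h_def power_0_left)
      then show ?thesis by (simp add: dvd_iff_poly_eq_0)
    qed
    have "inj_on (\<lambda>i. \<gamma> ^ i * \<alpha>) {..<q - 1}" using gamma(2) alpha(2) by (auto simp: inj_on_def)
    then have "card Z = q - 1" by (simp add: Z_def card_image)
    then show "Polynomial.degree h < 1 * card Z" using h assms by (simp add: base_polys_def)
  qed (simp add: Z_def)
  then show "f = f'" by (simp add: h_def)
qed

text \<open>The exponent range is shifted by one against \<open>gamma(2)\<close>, because the code
  evaluates at the exponents 1 to q - 1.\<close>

lemma gamma_power_inj: "inj_on (\<lambda>i. \<gamma> ^ i) {1..q - 1}"
proof (rule inj_onI)
  fix i j assume ij: "i \<in> {1..q - 1}" "j \<in> {1..q - 1}" "\<gamma> ^ i = \<gamma> ^ j"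
  then have "\<gamma> * \<gamma> ^ (i - 1) = \<gamma> * \<gamma> ^ (j - 1)" by (simp flip: power_Suc)
  then have "\<gamma> ^ (i - 1) = \<gamma> ^ (j - 1)" using gamma(3) by simp
  then have "i - 1 = j - 1" using ij by (intro inj_onD[OF gamma(2)]) auto
  then show "i = j" using ij by auto
qed

text \<open>The interpolating polynomial \<open>Q(Y\<^sub>1, \<dots>, Y\<^sub>s)\<close> has degree below \<open>b\<close> in each variable and vanishes to
  order \<open>r\<close> at every window of \<open>s\<close> consecutive entries of a symbol in \<open>S\<close>. By the degree bound
  \<open>Q(f(x), f(\<gamma> x), \<dots>)\<close> is the zero polynomial, and at \<open>x = \<alpha>\<close> Frobenius turns it into a nonzero
  univariate equation of degree below \<open>q ^ s\<close> for \<open>f(\<alpha>)\<close>, which determines \<open>f\<close>.\<close>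

lemma list_recovery:
  assumes k: "k < q - 1" and nm: "n * m \<le> q - 1"
    and F: "F \<subseteq> base_polys k"
    and S: "finite S" "\<And>j y. (j, y) \<in> S \<Longrightarrow> length y = m \<and> set y \<subseteq> base"
    and s: "0 < s" "s \<le> m" "b \<le> q"
    and count: "card S * m * 2 ^ (s + r) < b ^ s"
    and deg: "s * (b - 1) * k < r * (A * (m + 1 - s))"
    and agree: "\<And>f. f \<in> F \<Longrightarrow>
      A \<le> card {j. j < n \<and> (j, map (\<lambda>i. poly f (\<gamma> ^ (j * m + i))) [1..<m + 1]) \<in> S}"
  shows "finite F \<and> card F \<le> q ^ s"
proof -
  \<comment> \<open>\<open>B\<close> indexes the monomials of the interpolating polynomial and
    \<open>W\<close> the Taylor orders of total degree below r. There is one constraint in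
    \<open>J\<close> per symbol of S, window position and order; \<open>a\<close> is the Taylor
    coefficient of a monomial at that window. Window positions start at 1 and list positions at 0,
    hence \<open>w + i - 1\<close>.\<close>
  define B where "B = {..<s} \<rightarrow>\<^sub>E {..<b}"
  define W where "W = {e \<in> B. (\<Sum>i<s. e i) < r}"
  define J where "J = (S \<times> {1..m + 1 - s}) \<times> W"
  define a where "a = (\<lambda>((p :: nat \<times> 'a list, w), e') e. \<Prod>i<s.
    of_nat (e i choose e' i) * (snd p ! (w + i - 1)) ^ (e i - e' i) :: 'a)"
  have finB: "finite B" unfolding B_def by (intro finite_PiE) auto
  have finW: "finite W" using finB by (simp add: W_def)
  have a_base: "a j e \<in> base" if "j \<in> J" for j e
  proof -
    obtain p y w e' where j: "j = (((p, y), w), e')" by (cases j) auto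
    with that have y: "length y = m" "set y \<subseteq> base" and w: "1 \<le> w" "w \<le> m + 1 - s"
      using S(2)[of p y] by (auto simp: J_def)
    have "(\<Prod>i\<in>I. of_nat (e i choose e' i) * (y ! (w + i - 1)) ^ (e i - e' i)) \<in> base"
      if "I \<subseteq> {..<s}" for I
      using finite_subset[OF that finite_lessThan] that
    proof (induction I rule: finite_induct)
      case (insert i I)
      then have "w + i - 1 < length y" using y w by auto
      then have "y ! (w + i - 1) \<in> base" using y by (meson nth_mem subsetD)
      then show ?case using insert by (auto intro!: base_closed)
    qed (simp add: base_closed)
    then show ?thesis by (simp add: a_def j)
  qed
  \<comment> \<open>There are fewer constraints than coefficients, so a nonzero interpolating
    polynomial exists.\<close>
  have "card J = card S * (m + 1 - s) * card W" by (simp add: J_def card_cartesian_product)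
  also have "\<dots> \<le> card S * m * 2 ^ (s + r)"
    using card_box_weight_less[of s b r] s unfolding W_def B_def
    by (intro mult_mono mult_left_mono) simp_all
  also have "\<dots> < card B" using count by (simp add: B_def card_PiE)
  finally have "card J < card B" .
  then have "\<exists>c. (\<exists>e\<in>B. c e \<noteq> 0) \<and> (\<forall>j\<in>J. (\<Sum>e\<in>B. c e * a j e) = 0)"
    by (intro exists_nontrivial_solution[of base])
      (use finB finW S(1) a_base in \<open>simp_all add: J_def base_finite card_base base_closed\<close>)
  then obtain c where c: "\<exists>e\<in>B. c e \<noteq> 0" "\<And>j. j \<in> J \<Longrightarrow> (\<Sum>e\<in>B. c e * a j e) = 0"
    by blast
  define comp where "comp = (\<lambda>f i. pcompose f [:0, \<gamma> ^ i:])"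
  \<comment> \<open>Substitutes f(X), f(\<gamma> X), and so on into the interpolating polynomial
    with coefficients c.\<close>
  define R where "R = (\<lambda>f. \<Sum>e\<in>B. Polynomial.smult (c e) (\<Prod>i<s. comp f i ^ e i))"
  have smult_sum_right: "Polynomial.smult z (\<Sum>x\<in>I. g x) = (\<Sum>x\<in>I. Polynomial.smult z (g x))"
    for z :: 'a and I and g :: "(nat \<Rightarrow> nat) \<Rightarrow> 'a poly"
    by (induction I rule: infinite_finite_induct) (auto simp: smult_add_right)
  have poly_comp: "poly (comp f i) z = poly f (\<gamma> ^ i * z)" for f i z
    by (simp add: comp_def poly_pcompose mult.commute)
  \<comment> \<open>Expand \<open>R f\<close> around the window of y at w. Terms of order below r
    cancel by the constraints; each remaining term has at least r factors
    \<open>comp f i - Y i\<close>, all of which vanish at x.\<close>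
  have R_dvd: "[:- (\<gamma> ^ (j * m + w)), 1:] ^ r dvd R f"
    if J: "(j, map (\<lambda>i. poly f (\<gamma> ^ (j * m + i))) [1..<m + 1]) \<in> S" and w: "w \<in> {1..m + 1 - s}" for f j w
  proof -
    define y where "y = map (\<lambda>i. poly f (\<gamma> ^ (j * m + i))) [1..<m + 1]"
    define x where "x = \<gamma> ^ (j * m + w)"
    define Y where "Y = (\<lambda>i. [:y ! (w + i - 1):])"
    have y_nth: "y ! (w + i - 1) = poly f (\<gamma> ^ i * x)" if "i < s" for i
    proof -
      have "w + i - 1 < m" "1 + (w + i - 1) = w + i" using that w s by auto
      then show ?thesis by (simp add: y_def x_def power_add mult_ac del: upt_Suc One_nat_def)
    qed
    have "R f = (\<Sum>e\<in>B. \<Sum>e'\<in>B. Polynomial.smult (c e) (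
        (\<Prod>i<s. of_nat (e i choose e' i) * Y i ^ (e i - e' i)) * (\<Prod>i<s. (comp f i - Y i) ^ e' i)))"
      unfolding R_def
    proof (intro sum.cong refl)
      fix e assume "e \<in> B"
      then show "Polynomial.smult (c e) (\<Prod>i<s. comp f i ^ e i) = (\<Sum>e'\<in>B. Polynomial.smult (c e) (
        (\<Prod>i<s. of_nat (e i choose e' i) * Y i ^ (e i - e' i)) * (\<Prod>i<s. (comp f i - Y i) ^ e' i)))"
        by (subst sum_prod_taylor[where b = b and y = Y]) (auto simp: B_def smult_sum_right)
    qed
    also have "\<dots> = (\<Sum>e'\<in>B. (\<Sum>e\<in>B. Polynomial.smult (c e)
        (\<Prod>i<s. of_nat (e i choose e' i) * Y i ^ (e i - e' i))) * (\<Prod>i<s. (comp f i - Y i) ^ e' i))"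
      by (subst sum.swap) (simp add: sum_distrib_right)
    also have "[:- x, 1:] ^ r dvd \<dots>"
    proof (intro dvd_sum)
      fix e' assume e': "e' \<in> B"
      show "[:- x, 1:] ^ r dvd (\<Sum>e\<in>B. Polynomial.smult (c e)
        (\<Prod>i<s. of_nat (e i choose e' i) * Y i ^ (e i - e' i))) * (\<Prod>i<s. (comp f i - Y i) ^ e' i)"
      proof (cases "(\<Sum>i<s. e' i) < r")
        case True
        then have "((((j, y), w), e')) \<in> J" using J w e' by (simp add: J_def W_def y_def)
        from c(2)[OF this] have 0: "(\<Sum>e\<in>B. c e * (\<Prod>i<s.
            of_nat (e i choose e' i) * (y ! (w + i - 1)) ^ (e i - e' i))) = 0"
          by (simp add: a_def)
        have "(\<Prod>i\<in>I. of_nat (e i choose e' i) * Y i ^ (e i - e' i)) =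
            [:\<Prod>i\<in>I. of_nat (e i choose e' i) * (y ! (w + i - 1)) ^ (e i - e' i):]" for e I
          by (induction I rule: infinite_finite_induct)
            (auto simp: Y_def poly_const_pow of_nat_poly one_pCons mult_ac)
        then have "(\<Sum>e\<in>B. Polynomial.smult (c e)
            (\<Prod>i<s. of_nat (e i choose e' i) * Y i ^ (e i - e' i))) =
            (\<Sum>e\<in>B. [:c e * (\<Prod>i<s. of_nat (e i choose e' i) * (y ! (w + i - 1)) ^ (e i - e' i)):])"
          by simp
        also have "\<dots> = [:\<Sum>e\<in>B. c e * (\<Prod>i<s. of_nat (e i choose e' i) * (y ! (w + i - 1)) ^ (e i - e' i)):]"
          using finB by (induction B rule: finite_induct) auto
        finally show ?thesis using 0 by simp
      next
        case False
        have "[:- x, 1:] dvd comp f i - Y i" if "i < s" for i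
          using that by (simp add: dvd_iff_poly_eq_0 poly_comp Y_def y_nth del: One_nat_def)
        then have "(\<Prod>i<s. [:- x, 1:] ^ e' i) dvd (\<Prod>i<s. (comp f i - Y i) ^ e' i)"
          by (intro prod_dvd_prod dvd_power_same) auto
        then have "[:- x, 1:] ^ (\<Sum>i<s. e' i) dvd (\<Prod>i<s. (comp f i - Y i) ^ e' i)"
          by (simp add: power_sum)
        then have "[:- x, 1:] ^ r dvd (\<Prod>i<s. (comp f i - Y i) ^ e' i)"
          using False by (meson dvd_trans le_imp_power_dvd not_less)
        then show ?thesis by (rule dvd_mult)
      qed
    qed
    finally show ?thesis by (simp add: x_def)
  qed
  have R_degree: "Polynomial.degree (R f) \<le> s * (b - 1) * k" if "f \<in> base_polys k" for f
    unfolding R_def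
  proof (intro degree_sum_le finB order_trans[OF degree_smult_le])
    fix e assume e: "e \<in> B"
    have "Polynomial.degree (\<Prod>i<s. comp f i ^ e i) \<le> (\<Sum>i<s. Polynomial.degree (comp f i ^ e i))"
      using degree_prod_sum_le[of "{..<s}"] by (simp add: o_def)
    also have "\<dots> \<le> (\<Sum>i<s. (b - 1) * k)"
    proof (rule sum_mono)
      fix i assume i: "i \<in> {..<s}"
      have "Polynomial.degree (comp f i) \<le> Polynomial.degree f * 1"
        unfolding comp_def by (rule order_trans[OF degree_pcompose_le]) (auto intro: mult_left_mono)
      also have "\<dots> \<le> k" using that by (simp add: base_polys_def)
      finally have "Polynomial.degree (comp f i) \<le> k" .
      moreover have "e i \<le> b - 1" using e i by (force simp: B_def PiE_iff)
      ultimately have "Polynomial.degree (comp f i) * e i \<le> k * (b - 1)" by (rule mult_mono) auto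
      then show "Polynomial.degree (comp f i ^ e i) \<le> (b - 1) * k"
        using degree_power_le[of "comp f i" "e i"] by (simp add: mult.commute)
    qed
    finally show "Polynomial.degree (\<Prod>i<s. comp f i ^ e i) \<le> s * (b - 1) * k" by simp
  qed
  have R_zero: "R f = 0" if f: "f \<in> F" for f
  proof -
    define I where "I = {j. j < n \<and> (j, map (\<lambda>i. poly f (\<gamma> ^ (j * m + i))) [1..<m + 1]) \<in> S}"
    define Z where "Z = (\<lambda>(j, w). \<gamma> ^ (j * m + w)) ` (I \<times> {1..m + 1 - s})"
    have finI: "finite I" by (simp add: I_def)
    \<comment> \<open>All exponents lie in the range where powers of \<gamma> are distinct; j and w
      - 1 are then the quotient and remainder modulo m of the exponent minus one.\<close>
    have inj: "inj_on (\<lambda>(j, w). \<gamma> ^ (j * m + w)) (I \<times> {1..m + 1 - s})"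
    proof (rule inj_onI, clarify)
      fix j w j' w' assume j: "j \<in> I" "j' \<in> I" and w: "w \<in> {1..m + 1 - s}" "w' \<in> {1..m + 1 - s}"
        and eq: "\<gamma> ^ (j * m + w) = \<gamma> ^ (j' * m + w')"
      have bound: "i * m + v \<in> {1..q - 1}" if "i \<in> I" "v \<in> {1..m + 1 - s}" for i v
      proof -
        have "Suc i * m \<le> n * m" using that by (intro mult_right_mono) (auto simp: I_def)
        then show ?thesis using that s nm by auto
      qed
      have "j * m + w = j' * m + w'"
        using inj_onD[OF gamma_power_inj eq] bound j w by simp
      then have *: "j * m + (w - 1) = j' * m + (w' - 1)" using w by simp
      have "w - 1 < m" "w' - 1 < m" using w s by auto
      then have "j = j'" "w - 1 = w' - 1"
        using arg_cong[OF *, of "\<lambda>x. x div m"] arg_cong[OF *, of "\<lambda>x. x mod m"] by auto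
      then show "j = j' \<and> w = w'" using w by auto
    qed
    show ?thesis
    proof (rule sum_order_ge_imp_zero[of Z r])
      show "[:- x, 1:] ^ r dvd R f" if "x \<in> Z" for x
        using that R_dvd[of _ f] by (auto simp: Z_def I_def simp del: upt_Suc)
      show "finite Z" using finI by (simp add: Z_def)
      have "Polynomial.degree (R f) \<le> s * (b - 1) * k" using f F by (intro R_degree) auto
      also have "\<dots> < r * (A * (m + 1 - s))" by (rule deg)
      also have "\<dots> \<le> r * (card I * (m + 1 - s))"
        using agree[OF f] by (intro mult_left_mono mult_right_mono) (auto simp: I_def)
      also have "\<dots> = r * card Z"
        unfolding Z_def card_image[OF inj] card_cartesian_product by simp
      finally show "Polynomial.degree (R f) < r * card Z" .
    qed
  qed
  \<comment> \<open>Exponent tuples are read as base-q numerals. As all digits are below b \<le> q,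
    distinct tuples give distinct powers, so no coefficients of G merge and G inherits a nonzero
    coefficient from c.\<close>
  define num where "num = (\<lambda>e :: nat \<Rightarrow> nat. \<Sum>i<s. e i * q ^ i)"
  define G where "G = (\<Sum>e\<in>B. Polynomial.monom (c e) (num e))"
  have digit: "e i < q" if "e \<in> B" "i < s" for e i
    using that s(3) by (force simp: B_def PiE_iff)
  have num_inj: "e = e'" if "e \<in> B" "e' \<in> B" "num e = num e'" for e e'
  proof (rule PiE_ext[of e "{..<s}" "\<lambda>_. {..<b}"])
    show "e i = e' i" if "i \<in> {..<s}" for i
      using base_sum_inj[of s e q e' i] digit \<open>e \<in> B\<close> \<open>e' \<in> B\<close> \<open>num e = num e'\<close> that
      by (simp add: num_def)
  qed (use that in \<open>simp_all add: B_def\<close>)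
  have coeff_G: "Polynomial.coeff G (num e) = c e" if "e \<in> B" for e
  proof -
    have "Polynomial.coeff G (num e) = (\<Sum>e'\<in>B. if e' = e then c e' else 0)"
      unfolding G_def coeff_sum using num_inj that by (intro sum.cong) auto
    then show ?thesis using that finB by simp
  qed
  then have G: "G \<noteq> 0" using c(1) by force
  have "Polynomial.degree G \<le> q ^ s - 1"
    unfolding G_def
  proof (intro degree_sum_le finB order_trans[OF degree_monom_le])
    fix e assume "e \<in> B"
    then have "num e < q ^ s" unfolding num_def by (intro base_sum_less digit)
    then show "num e \<le> q ^ s - 1" by simp
  qed
  then have "card {z. poly G z = 0} \<le> q ^ s"
    using card_poly_roots_bound[OF G] by simp
  moreover have sub: "(\<lambda>f. poly f \<alpha>) ` F \<subseteq> {z. poly G z = 0}"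
  proof clarify
    fix f assume f: "f \<in> F"
    \<comment> \<open>At \<alpha> the shifted values become the powers f(\<alpha>)^(q^i), so the
      vanishing of \<open>R f\<close> says that f(\<alpha>) is a root of G.\<close>
    have "0 = poly (R f) \<alpha>" using R_zero[OF f] by simp
    also have "\<dots> = (\<Sum>e\<in>B. c e * (\<Prod>i<s. poly f (\<gamma> ^ i * \<alpha>) ^ e i))"
      by (simp add: R_def poly_sum poly_prod poly_comp)
    also have "\<dots> = (\<Sum>e\<in>B. c e * poly f \<alpha> ^ num e)"
    proof -
      have "f \<in> base_polys k" using f F by auto
      then have "(\<Prod>i<s. poly f (\<gamma> ^ i * \<alpha>) ^ e i) = poly f \<alpha> ^ num e" for e
        by (simp add: poly_iter num_def power_sum flip: power_mult) (simp add: mult.commute)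
      then show ?thesis by simp
    qed
    also have "\<dots> = poly G (poly f \<alpha>)" by (simp add: G_def poly_sum poly_monom)
    finally show "poly G (poly f \<alpha>) = 0" ..
  qed
  moreover have inj: "inj_on (\<lambda>f. poly f \<alpha>) F"
    using inj_on_eval[OF k] F by (rule inj_on_subset)
  moreover have "finite {z. poly G z = 0}" using G by (rule poly_roots_finite)
  ultimately show ?thesis
    by (meson card_inj_on_le finite_imageD finite_subset order_trans)
qed

end

section \<open>Embedding the base field into an algebraic closure\<close>

text \<open>Horner evaluation of a polynomial over F_2 in a ring given as a record. It lets
  polynomials over the type \<open>bit\<close> be evaluated both in K and in the algebraic
  closure.\<close>

fun bit_eval :: "('r, 'b) ring_scheme \<Rightarrow> 'r \<Rightarrow> bit list \<Rightarrow> 'r" where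
  "bit_eval R z [] = \<zero>\<^bsub>R\<^esub>"
| "bit_eval R z (a # as) = (if a = 1 then \<one>\<^bsub>R\<^esub> else \<zero>\<^bsub>R\<^esub>) \<oplus>\<^bsub>R\<^esub> z \<otimes>\<^bsub>R\<^esub> bit_eval R z as"

definition bit_poly_eval :: "('r, 'b) ring_scheme \<Rightarrow> 'r \<Rightarrow> bit poly \<Rightarrow> 'r" where
  "bit_poly_eval R z p = bit_eval R z (coeffs p)"

text \<open>In characteristic 2 sending a bit to 0 or 1 is a ring homomorphism, so evaluation at the
  marked point z is one on F_2[X]. The locale is instantiated at the generator of K and at a root in
  the closure.\<close>

locale char2_point = cring R for R (structure) +
  fixes z
  assumes two: "\<one> \<oplus> \<one> = \<zero>" and z [simp]: "z \<in> carrier R"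
begin

abbreviation "beval \<equiv> bit_poly_eval R z"
abbreviation "cf (a :: bit) \<equiv> if a = 1 then \<one> else \<zero>"

lemma add_self: "x \<in> carrier R \<Longrightarrow> x \<oplus> x = \<zero>"
  using two by (metis l_distr l_null l_one one_closed)

lemma beval_closed [simp]: "beval p \<in> carrier R"
proof -
  have "bit_eval R z as \<in> carrier R" for as by (induction as) auto
  then show ?thesis by (simp add: bit_poly_eval_def)
qed

lemma ev_0 [simp]: "beval 0 = \<zero>" by (simp add: bit_poly_eval_def)

lemma ev_pCons [simp]: "beval (pCons a p) = cf a \<oplus> z \<otimes> beval p"
  by (cases "a = 0 \<and> p = 0") (auto simp: bit_poly_eval_def cCons_def)

lemma cf_add: "cf (a + b) = cf a \<oplus> cf b"
  using two by (cases a; cases b) auto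

lemma ev_add: "beval (p + q) = beval p \<oplus> beval q"
proof (induction p q rule: poly_induct2)
  case (pCons a p b q)
  have "beval (pCons a p + pCons b q) = (cf a \<oplus> cf b) \<oplus> z \<otimes> (beval p \<oplus> beval q)"
    by (simp only: add_pCons ev_pCons pCons cf_add)
  also have "\<dots> = (cf a \<oplus> z \<otimes> beval p) \<oplus> (cf b \<oplus> z \<otimes> beval q)"
    by (simp add: r_distr a_ac)
  finally show ?case by (simp only: ev_pCons)
qed simp

lemma ev_smult: "beval (Polynomial.smult a p) = cf a \<otimes> beval p"
  by (cases a) auto

lemma ev_mult: "beval (p * q) = beval p \<otimes> beval q"
proof (induction p)
  case (pCons a p)
  have "beval (pCons a p * q) = cf a \<otimes> beval q \<oplus> z \<otimes> (beval p \<otimes> beval q)"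
    by (simp only: mult_pCons_left ev_add ev_smult ev_pCons pCons) simp
  also have "\<dots> = (cf a \<oplus> z \<otimes> beval p) \<otimes> beval q" by (simp add: l_distr m_assoc)
  finally show ?case by (simp only: ev_pCons)
qed simp

lemma ev_1: "beval 1 = \<one>" by (simp add: one_pCons)

lemma ev_monom: "beval (Polynomial.monom 1 i) = z [^] i"
  by (induction i) (simp_all add: monom_0 monom_Suc m_comm)

end

lemma two_eq_0_bit_closure: "(1 :: bit alg_closure) + 1 = 0"
proof -
  have "to_ac (1 + 1 :: bit) = 1 + 1" by (simp only: to_ac_add to_ac_1)
  then show ?thesis by simp
qed

lemma char2_point_bit_closure: "char2_point (ring_of_type_algebra :: bit alg_closure ring) z"
  unfolding char2_point_def char2_point_axioms_def
  using two_eq_0_bit_closure by (auto simp: ring_of_type_algebra_def[where 'a = "bit alg_closure"]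
      intro: cring_from_type_algebra[unfolded ring_of_type_algebra_def])

locale finite_field_generator = field K for K :: "'a ring" (structure) +
  fixes \<gamma> :: 'a and q :: nat
  assumes card_carrier: "card (carrier K) = q" and even_q: "even q" and q_pos: "0 < q"
    and gen: "is_generator K \<gamma>"
begin

lemma finite_carrier: "finite (carrier K)"
  using card_carrier q_pos card_ge_0_finite by auto

lemma gamma_closed [simp]: "\<gamma> \<in> carrier K" and gamma_neq_0: "\<gamma> \<noteq> \<zero>"
  and carrier_eq_powers: "carrier K - {\<zero>} = range (\<lambda>i :: nat. \<gamma> [^] i)"
proof -
  have "([^]\<^bsub>Ring_Divisibility.mult_of K\<^esub>) = (([^]) :: _ \<Rightarrow> nat \<Rightarrow> _)"
    by (simp add: Ring_Divisibility.mult_of_def nat_pow_def fun_eq_iff)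
  then show "\<gamma> \<in> carrier K" "\<gamma> \<noteq> \<zero>" "carrier K - {\<zero>} = range (\<lambda>i :: nat. \<gamma> [^] i)"
    using gen by (auto simp: is_generator_def)
qed

lemma two_le_q: "2 \<le> q"
  using card_carrier even_q q_pos by (metis One_nat_def Suc_leI dvd_imp_le)

lemma power_q_minus_1: "x \<in> carrier K \<Longrightarrow> x \<noteq> \<zero> \<Longrightarrow> x [^] (q - 1) = \<one>"
  using group.pow_order_eq_1[OF field_mult_group, of x] order_mult_of[OF finite_carrier] card_carrier
  by (simp add: Multiplicative_Group.nat_pow_mult_of order_def)

lemma power_q: "x \<in> carrier K \<Longrightarrow> x [^] q = x"
proof (cases "x = \<zero>")
  case False
  assume x: "x \<in> carrier K"
  have "x [^] q = x [^] Suc (q - 1)" using q_pos by simp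
  then show ?thesis using power_q_minus_1[OF x False] x by simp
qed (use q_pos in \<open>simp add: nat_pow_zero\<close>)

lemma nonzero_power:
  assumes "x \<in> carrier K" "x \<noteq> \<zero>" obtains i :: nat where "i < q - 1" "x = \<gamma> [^] i"
proof -
  have "x \<in> range (\<lambda>i :: nat. \<gamma> [^] i)" using assms carrier_eq_powers by blast
  then obtain i :: nat where i: "x = \<gamma> [^] i" by blast
  have "\<gamma> [^] i = \<gamma> [^] ((q - 1) * (i div (q - 1)) + i mod (q - 1))" by simp
  also have "\<dots> = (\<gamma> [^] (q - 1)) [^] (i div (q - 1)) \<otimes> \<gamma> [^] (i mod (q - 1))"
    by (simp only: nat_pow_mult[symmetric] nat_pow_pow gamma_closed)
  also have "\<dots> = \<gamma> [^] (i mod (q - 1))" by (simp add: power_q_minus_1 gamma_neq_0 del: One_nat_def)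
  finally show thesis using i two_le_q by (intro that[of "i mod (q - 1)"]) auto
qed

text \<open>These q - 1 exponents already reach all q - 1 nonzero elements, so no two powers can
  agree.\<close>

lemma gamma_inj: "inj_on (\<lambda>i :: nat. \<gamma> [^] i) {..<q - 1}"
proof (rule eq_card_imp_inj_on)
  have "(\<lambda>i :: nat. \<gamma> [^] i) ` {..<q - 1} = carrier K - {\<zero>}"
  proof (intro equalityI subsetI)
    fix x assume "x \<in> carrier K - {\<zero>}"
    then show "x \<in> (\<lambda>i :: nat. \<gamma> [^] i) ` {..<q - 1}"
      using nonzero_power[of x] by (metis DiffD1 DiffD2 imageI insertI1 lessThan_iff)
  next
    fix x assume "x \<in> (\<lambda>i :: nat. \<gamma> [^] i) ` {..<q - 1}"
    then show "x \<in> carrier K - {\<zero>}" using carrier_eq_powers by blast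
  qed
  then show "card ((\<lambda>i :: nat. \<gamma> [^] i) ` {..<q - 1}) = card {..<q - 1}"
    using finite_carrier card_carrier by simp
qed simp

text \<open>As q is even, q - 1 is odd, so 1 = (-1)^(q-1) = -1.\<close>

lemma two_eq_0: "\<one> \<oplus> \<one> = \<zero>"
proof -
  define j where "j = (q - 2) div 2"
  have "q - 1 = 2 * j + 1" using even_q two_le_q by (auto simp: j_def)
  then have "\<one> = (\<ominus> \<one>) [^] (2 * j + 1)" using power_q_minus_1[of "\<ominus> \<one>"] by simp
  also have "\<dots> = ((\<ominus> \<one>) [^] (2 :: nat)) [^] j \<otimes> \<ominus> \<one>"
    by (simp add: nat_pow_pow)
  also have "(\<ominus> \<one>) [^] (2 :: nat) = \<one>" by (simp add: numeral_2_eq_2 l_minus)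
  finally have "\<one> = \<ominus> \<one>" by simp
  then show ?thesis by (metis one_closed r_neg)
qed

text \<open>Both fields are quotients of polynomials over \<open>bit\<close>: the generator and a root of its minimal
  polynomial in the closure satisfy the same relations.\<close>

lemma embedding:
  obtains \<phi> :: "'a \<Rightarrow> bit alg_closure"
  where "\<phi> \<zero> = 0" "\<phi> \<one> = 1" "\<And>x y. x \<in> carrier K \<Longrightarrow> y \<in> carrier K \<Longrightarrow> \<phi> (x \<oplus> y) = \<phi> x + \<phi> y"
    "\<And>x y. x \<in> carrier K \<Longrightarrow> y \<in> carrier K \<Longrightarrow> \<phi> (x \<otimes> y) = \<phi> x * \<phi> y"
    "inj_on \<phi> (carrier K)"
proof -
  interpret E: char2_point K \<gamma> by unfold_locales (use two_eq_0 in auto)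
  have surj: "\<exists>p. E.beval p = x" if "x \<in> carrier K" for x
    using nonzero_power[OF that] E.ev_0 E.ev_monom by metis
  define Ker where "Ker = {p. p \<noteq> 0 \<and> E.beval p = \<zero>}"
  \<comment> \<open>X^q + X is nonzero as q \<ge> 2, and vanishes at \<gamma> because \<gamma>^q =
    \<gamma> and the sum of two equal terms is zero.\<close>
  have "Polynomial.monom 1 q + Polynomial.monom 1 1 \<in> Ker"
  proof -
    have "Polynomial.monom 1 q + Polynomial.monom 1 1 \<noteq> (0 :: bit poly)"
      using two_le_q arg_cong[of _ _ "\<lambda>p. Polynomial.coeff p 1"] by (metis Polynomial.coeff_0 coeff_add
        Polynomial.coeff_monom Suc_1 add_0_left not_less_eq_eq One_nat_def le_refl zero_neq_one)
    moreover have "E.beval (Polynomial.monom 1 q + Polynomial.monom 1 1) = \<zero>"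
      by (simp only: E.ev_add E.ev_monom) (simp add: power_q E.add_self)
    ultimately show ?thesis by (simp add: Ker_def)
  qed
  \<comment> \<open>A nonzero annihilator of least degree is the minimal polynomial of \<gamma>; by
    division with remainder it divides every other annihilator.\<close>
  then obtain \<mu> where mu: "\<mu> \<in> Ker" "\<And>p. p \<in> Ker \<Longrightarrow> Polynomial.degree \<mu> \<le> Polynomial.degree p"
    using ex_has_least_nat[of "\<lambda>p. p \<in> Ker" _ Polynomial.degree] by blast
  have dvd: "\<mu> dvd p" if "E.beval p = \<zero>" for p
  proof -
    have "E.beval p = E.beval (p div \<mu>) \<otimes> E.beval \<mu> \<oplus> E.beval (p mod \<mu>)"
      by (simp flip: E.ev_add E.ev_mult)
    moreover have "E.beval \<mu> = \<zero>" using mu(1) by (simp add: Ker_def)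
    ultimately have "E.beval (p mod \<mu>) = \<zero>" using that E.beval_closed by (metis l_zero r_null)
    then have "p mod \<mu> = 0" using mu degree_mod_less[of \<mu> p] by (force simp: Ker_def)
    then show ?thesis by (simp add: dvd_eq_mod_eq_0)
  qed
  \<comment> \<open>A nonzero constant is 1, which does not vanish. Positive degree then gives \<mu>
    a root \<beta> in the closure.\<close>
  have "Polynomial.degree \<mu> \<noteq> 0"
  proof
    assume "Polynomial.degree \<mu> = 0"
    then obtain a where a: "\<mu> = [:a:]" by (rule degree_eq_zeroE)
    then have "a = 1" using mu(1) by (cases a) (auto simp: Ker_def)
    then show False using a mu(1) by (simp add: Ker_def)
  qed
  moreover have "Polynomial.degree (map_poly to_ac \<mu>) = Polynomial.degree \<mu>"
    by (rule degree_map_poly) auto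
  ultimately obtain \<beta> :: "bit alg_closure" where beta: "poly (map_poly to_ac \<mu>) \<beta> = 0"
    using alg_closed_imp_poly_has_root[of "map_poly to_ac \<mu>"] by auto
  let ?L = "ring_of_type_algebra :: bit alg_closure ring"
  interpret L: char2_point ?L \<beta> by (rule char2_point_bit_closure)
  have L_simps [simp]: "x \<oplus>\<^bsub>?L\<^esub> y = x + y" "x \<otimes>\<^bsub>?L\<^esub> y = x * y" "\<zero>\<^bsub>?L\<^esub> = 0" "\<one>\<^bsub>?L\<^esub> = 1" for x y
    by (simp_all add: ring_of_type_algebra_def)
  have L_ev: "L.beval p = poly (map_poly to_ac p) \<beta>" for p
  proof (induction p)
    case (pCons a p)
    then show ?case by (cases a) (simp_all add: map_poly_pCons)
  qed simp
  \<comment> \<open>Polynomials with equal values at \<gamma> differ by a multiple of \<mu>, hence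
    agree at \<beta>. This makes \<phi> below independent of the chosen representative.\<close>
  have L_eq: "L.beval p = L.beval p'" if "E.beval p = E.beval p'" for p p'
  proof -
    have "E.beval (p + p') = \<zero>" using that by (simp only: E.ev_add E.add_self E.beval_closed)
    then obtain r where "p + p' = \<mu> * r" using dvd by blast
    then have "L.beval p + L.beval p' = L.beval \<mu> * L.beval r" by (metis L.ev_add L.ev_mult L_simps(1,2))
    also have "\<dots> = 0" using beta by (simp add: L_ev)
    finally show ?thesis using L.add_self[of "L.beval p'"] L.beval_closed[of p'] by (simp add: add_eq_0_iff2)
  qed
  define \<phi> where "\<phi> x = L.beval (SOME p. E.beval p = x)" for x
  have phi: "\<phi> (E.beval p) = L.beval p" for p
    unfolding \<phi>_def by (rule L_eq) (rule someI[of _ p], simp)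
  show thesis
  proof (rule that[of \<phi>])
    show "\<phi> \<zero> = 0" using phi[of 0] by simp
    show one: "\<phi> \<one> = 1" using phi[of 1] by (simp only: E.ev_1 L.ev_1 L_simps)
    show add: "\<phi> (x \<oplus> y) = \<phi> x + \<phi> y" if "x \<in> carrier K" "y \<in> carrier K" for x y
      using surj[OF that(1)] surj[OF that(2)] by (metis phi E.ev_add L.ev_add L_simps(1))
    show mult: "\<phi> (x \<otimes> y) = \<phi> x * \<phi> y" if "x \<in> carrier K" "y \<in> carrier K" for x y
      using surj[OF that(1)] surj[OF that(2)] by (metis phi E.ev_mult L.ev_mult L_simps(2))
    \<comment> \<open>In characteristic 2 the sum d of x and y is their difference. A nonzero d
      would be invertible, contradicting \<phi> d = 0.\<close>
    show "inj_on \<phi> (carrier K)"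
    proof (rule inj_onI, rule ccontr)
      fix x y assume xy: "x \<in> carrier K" "y \<in> carrier K" "\<phi> x = \<phi> y" "x \<noteq> y"
      define d where "d = x \<oplus> y"
      have d: "d \<in> carrier K" using xy by (simp add: d_def)
      have "d \<noteq> \<zero>" using xy by (metis d_def E.add_self a_assoc l_zero r_zero)
      then have "\<one> = d \<otimes> inv d" "inv d \<in> carrier K" using d by (simp_all add: field_Units)
      then have "1 = \<phi> d * \<phi> (inv d)" using one mult d by metis
      moreover have "\<phi> d = 0"
        using add[OF xy(1,2)] xy(3) L.add_self[of "\<phi> y"] by (simp add: d_def ring_of_type_algebra_def)
      ultimately show False by simp
    qed
  qed
qed

end

section \<open>The folded Reed-Solomon code\<close>

lemma bit_closure_frobenius: "(x + y :: bit alg_closure) ^ (2 ^ j) = x ^ (2 ^ j) + y ^ (2 ^ j)"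
proof (induction j)
  case (Suc j)
  have "(2 :: bit alg_closure) = 0" using two_eq_0_bit_closure by simp
  then have sq: "(u + v)\<^sup>2 = u\<^sup>2 + v\<^sup>2" for u v :: "bit alg_closure" by (simp add: power2_sum)
  have "(x + y) ^ (2 ^ Suc j) = ((x + y) ^ (2 ^ j))\<^sup>2" by (simp add: mult.commute flip: power_mult)
  also have "\<dots> = (x ^ (2 ^ j))\<^sup>2 + (y ^ (2 ^ j))\<^sup>2" by (simp only: Suc sq)
  also have "\<dots> = x ^ (2 ^ Suc j) + y ^ (2 ^ Suc j)" by (simp add: mult.commute flip: power_mult)
  finally show ?case .
qed simp

lemma par_n_mult_par_m: "par_n l * par_m l = par_q l - 1"
  using par_m_dvd_par_N by (simp add: par_n_def par_N_def)

lemma par_k_less: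
  assumes "2 \<le> par_q l"
  shows "par_k l < par_q l - 1"
proof -
  have N: "0 < par_N l" using assms by (simp add: par_N_def)
  then have "0 < par_n l" using par_n_mult_par_m[of l] by (metis par_N_def mult_is_0 neq0_conv)
  then have "1 \<le> sqrt (real (par_n l))" by simp
  then have "par_R l \<le> 1 / 10" by (simp add: par_R_def divide_le_eq)
  then have "par_R l * real (par_N l) \<le> 1 / 10 * real (par_N l)" by (intro mult_right_mono) auto
  also have "\<dots> < real (par_N l)" using N by simp
  finally have "\<lfloor>par_R l * real (par_N l)\<rfloor> < int (par_N l)" by (simp add: floor_less_iff)
  then show ?thesis using N by (simp add: par_k_def par_N_def)
qed

context finite_field_generator begin

lemma finite_alphabet: "finite (alphabet K l)"
  unfolding alphabet_def using finite_lists_length_eq[OF finite_carrier, of "par_m l"]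
  by (simp add: conj_commute)

text \<open>Transports \<open>list_recovery\<close> along the embedding of K into the closure of
  F_2. Message polynomials and the symbols in S are both carried over, and coordinate i becomes
  block i - 1.\<close>

lemma frs_list_recovery:
  assumes q: "q = par_q l"
    and S: "S \<subseteq> {1..par_n l} \<times> alphabet K l"
    and s: "0 < s" "s \<le> par_m l" "b \<le> q"
    and count: "card S * par_m l * 2 ^ (s + r) < b ^ s"
    and deg: "s * (b - 1) * par_k l < r * (A * (par_m l + 1 - s))"
    and C: "C \<subseteq> frs_code K \<gamma> l"
    and agree: "\<And>xs. xs \<in> C \<Longrightarrow> A \<le> card {i \<in> {1..par_n l}. (i, xs ! (i - 1)) \<in> S}"
  shows "finite C \<and> card C \<le> q ^ s"
proof -
  obtain \<phi> :: "'a \<Rightarrow> bit alg_closure" where phi: "\<phi> \<zero> = 0" "\<phi> \<one> = 1"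
    "\<And>x y. x \<in> carrier K \<Longrightarrow> y \<in> carrier K \<Longrightarrow> \<phi> (x \<oplus> y) = \<phi> x + \<phi> y"
    "\<And>x y. x \<in> carrier K \<Longrightarrow> y \<in> carrier K \<Longrightarrow> \<phi> (x \<otimes> y) = \<phi> x * \<phi> y"
    "inj_on \<phi> (carrier K)"
    by (rule embedding) (rule that; assumption)
  have phi_pow: "\<phi> (x [^] i) = \<phi> x ^ i" if "x \<in> carrier K" for x and i :: nat
    using that by (induction i) (simp_all add: phi)
  have phi_gamma: "\<phi> \<gamma> \<noteq> 0"
    using inj_onD[OF phi(5), of \<gamma> \<zero>] gamma_neq_0 phi(1) by auto
  \<comment> \<open>A (q-1)-th root exists by algebraic closedness and satisfies \<alpha>^q = \<phi>
    \<gamma> * \<alpha>.\<close>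
  obtain \<alpha> where alpha: "\<alpha> ^ (q - 1) = \<phi> \<gamma>"
    using nth_root_exists[of "q - 1" "\<phi> \<gamma>"] two_le_q by auto
  interpret M: frobenius_field q "\<phi> \<gamma>" \<alpha>
  proof
    show "(x + y) ^ q = x ^ q + y ^ q" for x y :: "bit alg_closure"
      unfolding q par_q_def by (rule bit_closure_frobenius)
    show "2 \<le> q" by (rule two_le_q)
    show "\<phi> \<gamma> ^ q = \<phi> \<gamma>" by (simp add: power_q flip: phi_pow)
    show "\<phi> \<gamma> \<noteq> 0" by (rule phi_gamma)
    show "\<alpha> \<noteq> 0" using alpha phi_gamma two_le_q by (auto simp: power_0_left split: if_splits)
    show "\<alpha> ^ q = \<phi> \<gamma> * \<alpha>"
      using power_Suc2[of \<alpha> "q - 1"] alpha q_pos by simp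
    have "inj_on (\<lambda>i. \<phi> (\<gamma> [^] i)) {..<q - 1}"
      by (rule inj_onI) (auto dest!: inj_onD[OF phi(5)] inj_onD[OF gamma_inj])
    then show "inj_on (\<lambda>i. \<phi> \<gamma> ^ i) {..<q - 1}" by (simp add: phi_pow)
  qed
  \<comment> \<open>Coefficient lists over K start with the leading coefficient, those of
    \<open>Poly\<close> with the constant one.\<close>
  define lift where "lift f = Poly (map \<phi> (rev f))" for f
  have poly_lift: "poly (lift f) (\<phi> x) = \<phi> (eval f x)" if "set f \<subseteq> carrier K" "x \<in> carrier K" for f x
    using that(1)
  proof (induction f)
    case (Cons a f)
    have "poly (lift (a # f)) (\<phi> x) = poly (lift f) (\<phi> x) + \<phi> x ^ length f * \<phi> a"
      by (simp add: lift_def Poly_append poly_monom)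
    with Cons that(2) show ?case
      by (simp add: phi phi_pow eval_in_carrier mult.commute add.commute)
  qed (simp add: lift_def phi)
  have "\<exists>G. \<forall>xs\<in>C. xs = codeword K \<gamma> l (G xs) \<and> set (G xs) \<subseteq> carrier K \<and> length (G xs) \<le> par_k l + 1"
    using C by (intro bchoice) (force simp: frs_code_def univ_poly_def polynomial_def)
  then obtain G where G: "\<And>xs. xs \<in> C \<Longrightarrow> xs = codeword K \<gamma> l (G xs)"
    "\<And>xs. xs \<in> C \<Longrightarrow> set (G xs) \<subseteq> carrier K" "\<And>xs. xs \<in> C \<Longrightarrow> length (G xs) \<le> par_k l + 1"
    by metis
  define F where "F = (\<lambda>xs. lift (G xs)) ` C"
  define S' where "S' = (\<lambda>(i, y). (i - 1, map \<phi> y)) ` S"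
  have symbol: "map (\<lambda>i. poly (lift (G xs)) (\<phi> \<gamma> ^ (j * par_m l + i))) [1..<par_m l + 1] = map \<phi> (xs ! j)"
    if xs: "xs \<in> C" and j: "j < par_n l" for xs j
  proof -
    have "xs ! j = map (\<lambda>i. eval (G xs) (\<gamma> [^] (j * par_m l + i))) [1..<par_m l + 1]"
    proof -
      have "codeword K \<gamma> l f ! j = map (\<lambda>i. eval f (\<gamma> [^] (j * par_m l + i))) [1..<par_m l + 1]" for f
        using j by (simp add: codeword_def del: upt_Suc)
      then show ?thesis using G(1)[OF xs] by metis
    qed
    then show ?thesis using G(2)[OF xs] by (simp add: poly_lift flip: phi_pow del: upt_Suc)
  qed
  have finS: "finite S" using S finite_alphabet by (meson finite_SigmaI finite_atLeastAtMost finite_subset)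
  have xs_carrier: "\<Union> (set ` set xs) \<subseteq> carrier K" if "xs \<in> C" for xs
  proof -
    have "\<Union> (set ` set (codeword K \<gamma> l (G xs))) \<subseteq> carrier K"
      using G(2)[OF that] by (auto simp: codeword_def intro!: eval_in_carrier)
    then show ?thesis by (simp only: G(1)[OF that, symmetric])
  qed
  \<comment> \<open>The lifted polynomial determines every symbol up to the injective \<phi>, so a
    bound on the polynomials bounds the codewords.\<close>
  have "inj_on (\<lambda>xs. lift (G xs)) C"
  proof (rule inj_onI)
    fix xs ys assume xs: "xs \<in> C" "ys \<in> C" and eq: "lift (G xs) = lift (G ys)"
    have len: "length xs = par_n l" "length ys = par_n l"
    proof -
      have "length (codeword K \<gamma> l f) = par_n l" for f by (simp add: codeword_def)
      then show "length xs = par_n l" "length ys = par_n l" using G(1) xs by metis+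
    qed
    show "xs = ys"
    proof (rule nth_equalityI)
      fix j assume j: "j < length xs"
      then have jn: "j < par_n l" using len by simp
      have "map \<phi> (xs ! j) = map \<phi> (ys ! j)"
        using symbol[OF xs(1) jn, unfolded eq] symbol[OF xs(2) jn] by (rule trans[OF sym])
      moreover have "set (xs ! j) \<subseteq> carrier K" "set (ys ! j) \<subseteq> carrier K"
        using xs_carrier[OF xs(1)] xs_carrier[OF xs(2)] jn len by (simp_all add: UN_subset_iff)
      then have "inj_on \<phi> (set (xs ! j) \<union> set (ys ! j))" by (intro inj_on_subset[OF phi(5)]) simp
      ultimately show "xs ! j = ys ! j" by (simp add: inj_on_map_eq_map)
    qed (simp add: len)
  qed
  then have card_F: "card F = card C" and fin_F: "finite F \<longleftrightarrow> finite C"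
    by (simp_all add: F_def card_image finite_image_iff)
  have "finite F \<and> card F \<le> q ^ s"
  proof (rule M.list_recovery[where n = "par_n l" and m = "par_m l" and S = S' and k = "par_k l"])
    show "par_k l < q - 1" unfolding q by (rule par_k_less) (use two_le_q q in simp)
    show "par_n l * par_m l \<le> q - 1" by (simp add: q par_n_mult_par_m)
    show "finite S'" using finS by (simp add: S'_def)
    have phi_base: "\<phi> a \<in> M.base" if "a \<in> carrier K" for a
      using that by (simp add: M.base_def power_q flip: phi_pow)
    show "length y = par_m l \<and> set y \<subseteq> M.base" if "(j, y) \<in> S'" for j y
    proof -
      obtain i b where "(i, b) \<in> S" and y: "y = map \<phi> b" using \<open>(j, y) \<in> S'\<close> by (auto simp: S'_def)
      then have "b \<in> alphabet K l" using S by blast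
      then show ?thesis by (auto simp: y alphabet_def intro!: phi_base)
    qed
    show "F \<subseteq> M.base_polys (par_k l)"
    proof
      fix f assume "f \<in> F"
      then obtain xs where xs: "xs \<in> C" "f = lift (G xs)" by (auto simp: F_def)
      have "Polynomial.coeff f i \<in> M.base" for i
        using G(2)[OF xs(1)] nth_mem[of i "rev (G xs)"] unfolding xs(2) lift_def
        by (auto simp: nth_default_def M.base_closed intro!: phi_base)
      moreover have "Polynomial.degree f \<le> par_k l"
        using G(3)[OF xs(1)] unfolding xs(2) lift_def
        by (intro degree_le) (auto simp: nth_default_def)
      ultimately show "f \<in> M.base_polys (par_k l)" by (simp add: M.base_polys_def)
    qed
    show "card S' * par_m l * 2 ^ (s + r) < b ^ s"
    proof -
      have "card S' \<le> card S" unfolding S'_def by (rule card_image_le[OF finS])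
      then show ?thesis using count by (meson le_less_trans mult_le_mono1)
    qed
    show "A \<le> card {j. j < par_n l \<and>
        (j, map (\<lambda>i. poly f (\<phi> \<gamma> ^ (j * par_m l + i))) [1..<par_m l + 1]) \<in> S'}" (is "_ \<le> card ?J")
      if f: "f \<in> F" for f
    proof -
      obtain xs where xs: "xs \<in> C" "f = lift (G xs)" using f by (auto simp: F_def)
      let ?I = "{i \<in> {1..par_n l}. (i, xs ! (i - 1)) \<in> S}"
      have "A \<le> card ?I" using agree[OF xs(1)] .
      also have "\<dots> \<le> card ?J"
      proof (rule card_inj_on_le)
        show "inj_on (\<lambda>i. i - 1) ?I" by (auto simp: inj_on_def)
        show "(\<lambda>i. i - 1) ` ?I \<subseteq> ?J"
        proof (rule image_subsetI)
          fix i assume i: "i \<in> ?I"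
          then have "i - 1 < par_n l" by auto
          moreover have "(i - 1, map \<phi> (xs ! (i - 1))) \<in> S'" using i by (force simp: S'_def)
          ultimately show "i - 1 \<in> ?J" by (simp only: xs(2) symbol[OF xs(1)] mem_Collect_eq)
        qed
      qed simp
      finally show ?thesis .
    qed
  qed (use s deg in auto)
  then show ?thesis using card_F fin_F by simp
qed

end

section \<open>Hybrid bounds on query weights\<close>

text \<open>For t < \<open>num_queries A\<close> this is the norm, just before query t counted from
  0, of the part of the state whose query register holds a point of P.\<close>

definition query_amp :: "'p query_algorithm \<Rightarrow> oracle_fun \<Rightarrow> bool list set \<Rightarrow> nat \<Rightarrow> real" where
  "query_amp A F P t = L2_set (\<lambda>a. cmod (state_after A F t a)) {a \<in> labels A. fst a \<in> P}"

text \<open>The query magnitude of the quantum hybrid argument.\<close>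

definition query_weight :: "'p query_algorithm \<Rightarrow> oracle_fun \<Rightarrow> bool list set \<Rightarrow> real" where
  "query_weight A F P = (\<Sum>t<num_queries A. (query_amp A F P t)\<^sup>2)"

lemma query_amp_nonneg [simp]: "0 \<le> query_amp A F P t"
  by (simp add: query_amp_def)

lemma query_weight_nonneg [simp]: "0 \<le> query_weight A F P"
  by (simp add: query_weight_def sum_nonneg)

lemma sum_query_amp_squared_le:
  "(\<Sum>t<num_queries A. query_amp A F P t)\<^sup>2 \<le> num_queries A * query_weight A F P"
  using sum_squared_le_sum_of_squares[of "query_amp A F P" "{..<num_queries A}"]
  by (simp add: query_weight_def mult.commute)

text \<open>A query permutes the basis states and leaves the query register unchanged.\<close>

lemma query_op_norm_on:
  "L2_set (\<lambda>a. cmod (query_op F \<psi> a)) {a \<in> labels A. fst a \<in> P} =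
   L2_set (\<lambda>a. cmod (\<psi> a)) {a \<in> labels A. fst a \<in> P}"
proof -
  define f :: "label \<Rightarrow> label" where
    "f = (\<lambda>(x, y, w). (x, map2 (\<noteq>) y (answer F x (length y)), w))"
  let ?L = "{a \<in> labels A. fst a \<in> P}"
  have len: "length (answer F x k) = k" for x k by (simp add: answer_def)
  have "f (f a) = a" for a
    by (cases a) (simp add: f_def len map2_xor_invol)
  moreover have "f a \<in> ?L" if "a \<in> ?L" for a
    using that by (auto simp: f_def labels_def len)
  ultimately have "bij_betw f ?L ?L"
    by (intro bij_betw_byWitness[where f' = f]) auto
  then have "(\<Sum>a\<in>?L. (cmod (\<psi> (f a)))\<^sup>2) = (\<Sum>a\<in>?L. (cmod (\<psi> a))\<^sup>2)"
    by (rule sum.reindex_bij_betw)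
  then show ?thesis by (simp add: f_def query_op_def case_prod_unfold L2_set_def)
qed

lemma L2_set_cmod_add:
  "L2_set (\<lambda>a. cmod (\<psi> a)) L \<le>
   L2_set (\<lambda>a. cmod (\<phi> a)) L + L2_set (\<lambda>a. cmod (\<psi> a - \<phi> a)) L"
proof -
  have "L2_set (\<lambda>a. cmod (\<psi> a)) L \<le> L2_set (\<lambda>a. cmod (\<phi> a) + cmod (\<psi> a - \<phi> a)) L"
    by (intro L2_set_mono) (auto simp: norm_triangle_sub)
  also have "\<dots> \<le> L2_set (\<lambda>a. cmod (\<phi> a)) L + L2_set (\<lambda>a. cmod (\<psi> a - \<phi> a)) L"
    by (rule L2_set_triangle_ineq)
  finally show ?thesis .
qed

lemma L2_set_subset:
  assumes "finite L" "M \<subseteq> L"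
  shows "L2_set f M \<le> L2_set f L"
  unfolding L2_set_def using assms by (intro real_sqrt_le_mono sum_mono2) auto

text \<open>Unitaries and a common query preserve the distance between the two runs. Changing the
  oracle affects only basis states that query P, which adds at most twice the amplitude on P at each
  query.\<close>

lemma hybrid_bound:
  assumes A: "valid_algorithm A" and t: "t \<le> num_queries A"
    and agree: "\<And>x i. x \<notin> P \<Longrightarrow> F (x, i) = F' (x, i)"
  shows "L2_set (\<lambda>a. cmod (state_after A F t a - state_after A F' t a)) (labels A)
    \<le> 2 * (\<Sum>u<t. query_amp A F P u)"
  using t
proof (induction t)
  case 0
  then show ?case by (simp add: L2_set_def)
next
  case (Suc t)
  let ?L = "labels A" and ?P = "{a \<in> labels A. fst a \<in> P}"
  let ?s = "state_after A F t" and ?s' = "state_after A F' t"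
  let ?d = "\<lambda>a. query_op F ?s a - query_op F' ?s' a"
  have "state_after A F (Suc t) a - state_after A F' (Suc t) a
      = apply_op ?L (unitary A (Suc t)) ?d a" for a
    by (simp add: apply_op_def sum_subtractf right_diff_distrib)
  moreover have "unitary_on ?L (unitary A (Suc t))"
    using A Suc.prems by (simp add: valid_algorithm_def)
  ultimately have "L2_set (\<lambda>a. cmod (state_after A F (Suc t) a - state_after A F' (Suc t) a)) ?L
      = L2_set (\<lambda>a. cmod (?d a)) ?L"
    by (simp only: L2_set_def apply_op_norm[OF finite_labels])
  \<comment> \<open>Answering both runs with F' keeps the old distance; what remains is the effect
    of exchanging the oracle on the state of the first run.\<close>
  also have "\<dots> \<le> L2_set (\<lambda>a. cmod (query_op F' (\<lambda>a. ?s a - ?s' a) a)) ?L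
      + L2_set (\<lambda>a. cmod (?d a - query_op F' (\<lambda>a. ?s a - ?s' a) a)) ?L"
    by (rule L2_set_cmod_add)
  also have "L2_set (\<lambda>a. cmod (query_op F' (\<lambda>a. ?s a - ?s' a) a)) ?L
      = L2_set (\<lambda>a. cmod (?s a - ?s' a)) ?L"
    by (simp only: L2_set_def query_op_norm)
  also have "\<dots> \<le> 2 * (\<Sum>u<t. query_amp A F P u)" using Suc by simp
  also have "L2_set (\<lambda>a. cmod (?d a - query_op F' (\<lambda>a. ?s a - ?s' a) a)) ?L
      = L2_set (\<lambda>a. cmod (query_op F ?s a - query_op F' ?s a)) ?L"
    by (simp add: query_op_def case_prod_unfold)
  also have "\<dots> = L2_set (\<lambda>a. cmod (query_op F ?s a - query_op F' ?s a)) ?P"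
  proof -
    have "cmod (query_op F ?s a - query_op F' ?s a) = 0" if "fst a \<notin> P" for a
      using agree[OF that] by (simp add: query_op_def case_prod_unfold answer_def)
    then show ?thesis
      unfolding L2_set_def by (intro arg_cong[where f = sqrt] sum.mono_neutral_right) auto
  qed
  also have "\<dots> \<le> L2_set (\<lambda>a. cmod (query_op F ?s a) + cmod (query_op F' ?s a)) ?P"
    by (intro L2_set_mono norm_triangle_ineq4) auto
  also have "\<dots> \<le> L2_set (\<lambda>a. cmod (query_op F ?s a)) ?P + L2_set (\<lambda>a. cmod (query_op F' ?s a)) ?P"
    by (rule L2_set_triangle_ineq)
  also have "\<dots> = 2 * query_amp A F P t"
    by (simp add: query_op_norm_on query_amp_def)
  finally show ?case by (simp add: algebra_simps)
qed

text \<open>The runs diverge only through queries to P, so the comparison is multiplicative. An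
  amplitude under F is at most twice the sum of those under F'; by Cauchy-Schwarz its square is at
  most 4 Q times the weight under F', and there are Q queries.\<close>

lemma query_weight_hybrid:
  assumes "valid_algorithm A" "\<And>x i. x \<notin> P \<Longrightarrow> F (x, i) = F' (x, i)"
  shows "query_weight A F P \<le> 4 * (num_queries A)\<^sup>2 * query_weight A F' P"
proof -
  let ?Q = "num_queries A" and ?S = "\<Sum>u<num_queries A. query_amp A F' P u"
  have "(query_amp A F P t)\<^sup>2 \<le> 4 * (?Q * query_weight A F' P)" if t: "t < ?Q" for t
  proof -
    have "query_amp A F P t \<le> query_amp A F' P t
        + L2_set (\<lambda>a. cmod (state_after A F t a - state_after A F' t a)) {a \<in> labels A. fst a \<in> P}"
      unfolding query_amp_def by (rule L2_set_cmod_add)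
    also have "L2_set (\<lambda>a. cmod (state_after A F t a - state_after A F' t a)) {a \<in> labels A. fst a \<in> P}
        \<le> L2_set (\<lambda>a. cmod (state_after A F t a - state_after A F' t a)) (labels A)"
      by (rule L2_set_subset) auto
    also have "\<dots> \<le> 2 * (\<Sum>u<t. query_amp A F' P u)"
      using hybrid_bound[OF assms(1), of t P F' F] assms(2) t by (simp add: norm_minus_commute)
    also have "query_amp A F' P t + 2 * (\<Sum>u<t. query_amp A F' P u) \<le> 2 * (\<Sum>u<Suc t. query_amp A F' P u)"
      by simp
    also have "(\<Sum>u<Suc t. query_amp A F' P u) \<le> ?S"
      using t by (intro sum_mono2) auto
    finally have "(query_amp A F P t)\<^sup>2 \<le> (2 * ?S)\<^sup>2" by (intro power_mono) auto
    then show ?thesis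
      using sum_query_amp_squared_le[of A F' P] by (simp add: power_mult_distrib)
  qed
  then have "query_weight A F P \<le> (\<Sum>t<?Q. 4 * (?Q * query_weight A F' P))"
    unfolding query_weight_def[of A F P] by (intro sum_mono) auto
  then show ?thesis by (simp add: power2_eq_square mult_ac)
qed

lemma pmf_output_eq:
  assumes "valid_algorithm A"
  shows "pmf (output_pmf A F) z =
    (\<Sum>a\<in>{a \<in> labels A. readout A a = z}. (cmod (state_after A F (num_queries A) a))\<^sup>2)"
proof -
  let ?M = "measurement_pmf A F" and ?R = "{a \<in> labels A. readout A a = z}"
  have "set_pmf ?M \<subseteq> labels A"
    using pmf_measurement_pmf[OF assms, of F] by (auto simp: set_pmf_iff split: if_splits)
  then have "readout A -` {z} \<inter> set_pmf ?M = ?R \<inter> set_pmf ?M" by auto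
  then have "pmf (output_pmf A F) z = measure_pmf.prob ?M ?R"
    using measure_Int_set_pmf[of ?M "readout A -` {z}"] measure_Int_set_pmf[of ?M ?R]
    by (simp only: output_pmf_def pmf_map)
  also have "\<dots> = (\<Sum>a\<in>?R. pmf ?M a)" by (rule measure_measure_pmf_finite) simp
  finally show ?thesis by (simp add: pmf_measurement_pmf[OF assms])
qed

text \<open>The final states differ by at most twice the summed amplitudes on P. The constants 2 and
  8 come from (a + b)^2 \<le> 2 a^2 + 2 b^2 and Cauchy-Schwarz.\<close>

lemma output_hybrid:
  assumes "valid_algorithm A" "\<And>x i. x \<notin> P \<Longrightarrow> F (x, i) = F' (x, i)"
  shows "pmf (output_pmf A F) z
    \<le> 2 * pmf (output_pmf A F') z + 8 * num_queries A * query_weight A F' P"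
proof -
  let ?Q = "num_queries A" and ?R = "{a \<in> labels A. readout A a = z}"
  let ?S = "\<Sum>u<num_queries A. query_amp A F' P u"
  have sq: "pmf (output_pmf A G) z = (L2_set (\<lambda>a. cmod (state_after A G ?Q a)) ?R)\<^sup>2" for G
    by (simp add: pmf_output_eq[OF assms(1)] L2_set_def sum_nonneg)
  define p where "p = L2_set (\<lambda>a. cmod (state_after A F' ?Q a)) ?R"
  have "L2_set (\<lambda>a. cmod (state_after A F ?Q a)) ?R
      \<le> p + L2_set (\<lambda>a. cmod (state_after A F ?Q a - state_after A F' ?Q a)) ?R"
    unfolding p_def by (rule L2_set_cmod_add)
  also have "L2_set (\<lambda>a. cmod (state_after A F ?Q a - state_after A F' ?Q a)) ?R
      \<le> L2_set (\<lambda>a. cmod (state_after A F ?Q a - state_after A F' ?Q a)) (labels A)"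
    by (rule L2_set_subset) auto
  also have "\<dots> \<le> 2 * ?S"
    using hybrid_bound[OF assms(1) order_refl, of P F' F] assms(2) by (simp add: norm_minus_commute)
  finally have "pmf (output_pmf A F) z \<le> (p + 2 * ?S)\<^sup>2"
    unfolding sq by (intro power_mono) auto
  also have "\<dots> \<le> 2 * p\<^sup>2 + 2 * (2 * ?S)\<^sup>2"
    using sum_squares_bound[of p "2 * ?S"] unfolding power2_sum by linarith
  also have "\<dots> \<le> 2 * p\<^sup>2 + 8 * (?Q * query_weight A F' P)"
    using sum_query_amp_squared_le[of A F' P] by (simp add: power_mult_distrib)
  finally show ?thesis by (simp add: sq p_def)
qed

lemma query_weight_sum:
  assumes "finite P"
  shows "query_weight A F P = (\<Sum>x\<in>P. query_weight A F {x})"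
proof -
  have "(query_amp A F P t)\<^sup>2 = (\<Sum>x\<in>P. (query_amp A F {x} t)\<^sup>2)" for t
  proof -
    have amp: "(query_amp A F R t)\<^sup>2 =
        (\<Sum>a\<in>{a \<in> labels A. fst a \<in> R}. (cmod (state_after A F t a))\<^sup>2)" for R
      by (simp add: query_amp_def L2_set_def sum_nonneg)
    have "(query_amp A F P t)\<^sup>2 = (\<Sum>x\<in>P. \<Sum>a\<in>{a \<in> {a \<in> labels A. fst a \<in> P}. fst a = x}.
        (cmod (state_after A F t a))\<^sup>2)"
      unfolding amp by (rule sum.group[symmetric]) (use assms in auto)
    also have "\<dots> = (\<Sum>x\<in>P. (query_amp A F {x} t)\<^sup>2)"
      unfolding amp by (intro sum.cong refl) auto
    finally show ?thesis .
  qed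
  then show ?thesis unfolding query_weight_def by (simp only:) (rule sum.swap)
qed

lemma query_weight_le:
  assumes "valid_algorithm A"
  shows "query_weight A F P \<le> num_queries A"
proof -
  have "(query_amp A F P t)\<^sup>2 \<le> 1" if "t < num_queries A" for t
  proof -
    have "query_amp A F P t \<le> L2_set (\<lambda>a. cmod (state_after A F t a)) (labels A)"
      unfolding query_amp_def by (rule L2_set_subset) auto
    also have "\<dots> = 1" using state_after_norm[OF assms, of t F] that by (simp add: L2_set_def)
    finally show ?thesis by (simp add: power_le_one)
  qed
  then have "query_weight A F P \<le> (\<Sum>t<num_queries A. 1)"
    unfolding query_weight_def by (intro sum_mono) auto
  then show ?thesis by simp
qed

text \<open>Weights of single points add up, and their total is at most one per query.\<close>

lemma card_heavy_le:
  assumes "valid_algorithm A" "finite S" "0 < \<tau>" "\<And>x. x \<in> S \<Longrightarrow> \<tau> \<le> query_weight A F {x}"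
  shows "real (card S) * \<tau> \<le> num_queries A"
proof -
  have "real (card S) * \<tau> = (\<Sum>x\<in>S. \<tau>)" by simp
  also have "\<dots> \<le> (\<Sum>x\<in>S. query_weight A F {x})" using assms(4) by (rule sum_mono)
  also have "\<dots> = query_weight A F S" by (rule query_weight_sum[OF assms(2), symmetric])
  also have "\<dots> \<le> num_queries A" by (rule query_weight_le[OF assms(1)])
  finally show ?thesis .
qed

section \<open>Random reprogramming\<close>

text \<open>The probability that a random subset of I, containing each element independently with
  probability p, equals D.\<close>

definition subset_weight :: "real \<Rightarrow> 'i set \<Rightarrow> 'i set \<Rightarrow> real" where
  "subset_weight p I D = p ^ card D * (1 - p) ^ card (I - D)"

lemma subset_weight_nonneg: "0 \<le> p \<Longrightarrow> p \<le> 1 \<Longrightarrow> 0 \<le> subset_weight p I D"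
  by (simp add: subset_weight_def)

lemma sum_subset_weight:
  assumes "finite I"
  shows "(\<Sum>D\<in>Pow I. subset_weight p I D) = 1"
proof -
  have "(\<Sum>D\<in>Pow I. subset_weight p I D) = (\<Sum>D\<in>Pow I. (\<Prod>i\<in>D. p) * (\<Prod>i\<in>I - D. 1 - p))"
    by (simp add: subset_weight_def)
  also have "\<dots> = (\<Prod>i\<in>I. p + (1 - p))" by (rule prod_add[OF assms, symmetric])
  finally show ?thesis by simp
qed

lemma subset_weight_insert:
  assumes "finite I" "i \<in> I" "D \<subseteq> I - {i}"
  shows "(1 - p) * subset_weight p I (insert i D) = p * subset_weight p I D"
proof -
  have fin: "finite D" using assms finite_subset by blast
  have "I - D = insert i (I - insert i D)" using assms by auto
  then have "card (I - D) = Suc (card (I - insert i D))"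
    using assms(1) by (metis card_insert_disjoint DiffD2 finite_Diff insertI1)
  moreover have "card (insert i D) = Suc (card D)" using assms fin by (intro card_insert_disjoint) auto
  ultimately show ?thesis by (simp add: subset_weight_def)
qed

text \<open>For fixed i, pair each D containing i with D - {i}; the probabilities have ratio p to 1
  - p. By \<open>edge\<close>, every hit of i at D is paid for by i lying in S at D - {i}, a set
  whose choice does not involve i.\<close>

lemma sum_hit_le_sum_sensitive:
  assumes I: "finite I" and p: "0 \<le> p" "p \<le> 1"
    and edge: "\<And>D i. D \<subseteq> I \<Longrightarrow> i \<in> D \<Longrightarrow> i \<in> T D \<Longrightarrow> i \<in> S (D - {i})"
    and S: "\<And>D. D \<subseteq> I \<Longrightarrow> S D \<subseteq> I"
  shows "(1 - p) * (\<Sum>D\<in>Pow I. subset_weight p I D * card (D \<inter> T D))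
    \<le> p * (\<Sum>D\<in>Pow I. subset_weight p I D * card (S D))"
proof -
  let ?w = "subset_weight p I"
  have card_eq: "real (card M) = (\<Sum>i\<in>I. of_bool (i \<in> M))" if "M \<subseteq> I" for M
    using that I by (simp add: sum.If_cases Int_absorb1 of_bool_def)
  have "(1 - p) * (\<Sum>D\<in>Pow I. ?w D * card (D \<inter> T D))
      = (\<Sum>i\<in>I. \<Sum>D\<in>Pow I. (1 - p) * (?w D * of_bool (i \<in> D \<inter> T D)))"
  proof -
    have "(\<Sum>D\<in>Pow I. ?w D * card (D \<inter> T D)) = (\<Sum>D\<in>Pow I. \<Sum>i\<in>I. ?w D * of_bool (i \<in> D \<inter> T D))"
      by (intro sum.cong refl) (subst card_eq, auto simp: sum_distrib_left)
    then show ?thesis by (subst sum.swap) (simp only: sum_distrib_left)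
  qed
  also have "\<dots> \<le> (\<Sum>i\<in>I. \<Sum>D\<in>Pow I. p * (?w D * of_bool (i \<in> S D)))"
  proof (rule sum_mono)
    fix i assume i: "i \<in> I"
    have "(\<Sum>D\<in>Pow I. (1 - p) * (?w D * of_bool (i \<in> D \<inter> T D)))
        = (\<Sum>D\<in>insert i ` Pow (I - {i}). (1 - p) * (?w D * of_bool (i \<in> D \<inter> T D)))"
    proof (rule sum.mono_neutral_right)
      show "insert i ` Pow (I - {i}) \<subseteq> Pow I" using i by auto
      have "D \<in> insert i ` Pow (I - {i})" if "D \<in> Pow I" "i \<in> D" for D
        using that by (intro image_eqI[of _ _ "D - {i}"]) auto
      then show "\<forall>D\<in>Pow I - insert i ` Pow (I - {i}). (1 - p) * (?w D * of_bool (i \<in> D \<inter> T D)) = 0"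
        by auto
    qed (use I in simp)
    also have "\<dots> = (\<Sum>D\<in>Pow (I - {i}). (1 - p) * (?w (insert i D) * of_bool (i \<in> T (insert i D))))"
      by (subst sum.reindex) (auto simp: inj_on_def)
    also have "\<dots> \<le> (\<Sum>D\<in>Pow (I - {i}). p * (?w D * of_bool (i \<in> S D)))"
    proof (rule sum_mono)
      fix D assume D: "D \<in> Pow (I - {i})"
      have "i \<in> S D" if "i \<in> T (insert i D)"
      proof -
        have "insert i D - {i} = D" using D by auto
        then show ?thesis using edge[of "insert i D" i] that D i by auto
      qed
      then have "of_bool (i \<in> T (insert i D)) \<le> (of_bool (i \<in> S D) :: real)" by auto
      then have "(1 - p) * ?w (insert i D) * of_bool (i \<in> T (insert i D)) \<le>
          (1 - p) * ?w (insert i D) * of_bool (i \<in> S D)"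
        using p subset_weight_nonneg[OF p] by (intro mult_left_mono mult_nonneg_nonneg) auto
      also have "\<dots> = p * ?w D * of_bool (i \<in> S D)"
        using D by (simp add: subset_weight_insert[OF I i])
      finally show "(1 - p) * (?w (insert i D) * of_bool (i \<in> T (insert i D))) \<le> p * (?w D * of_bool (i \<in> S D))"
        by (simp only: mult.assoc)
    qed
    also have "\<dots> \<le> (\<Sum>D\<in>Pow I. p * (?w D * of_bool (i \<in> S D)))"
      using I p by (intro sum_mono2 mult_nonneg_nonneg subset_weight_nonneg) auto
    finally show "(\<Sum>D\<in>Pow I. (1 - p) * (?w D * of_bool (i \<in> D \<inter> T D)))
        \<le> (\<Sum>D\<in>Pow I. p * (?w D * of_bool (i \<in> S D)))" .
  qed
  also have "\<dots> = p * (\<Sum>D\<in>Pow I. ?w D * card (S D))"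
  proof -
    have "(\<Sum>D\<in>Pow I. ?w D * card (S D)) = (\<Sum>D\<in>Pow I. \<Sum>i\<in>I. ?w D * of_bool (i \<in> S D))"
      by (intro sum.cong refl) (subst card_eq, use S in \<open>auto simp: sum_distrib_left\<close>)
    then show ?thesis by (subst sum.swap) (simp only: sum_distrib_left)
  qed
  finally show ?thesis .
qed

text \<open>If G has probability at least 1/2, the bound follows from card I \<ge> 2. Otherwise D
  meets T D with probability at least 1/2, so S D has expected size at least (1 - p) / (2 p) \<ge> a
  + 1. Since a size never exceeds card I, it reaches a with probability at least 1 / card I.\<close>

lemma many_sensitive:
  fixes a p :: real
  assumes I: "finite I" "2 \<le> card I" and p: "0 < p" "p < 1"
    and edge: "\<And>D i. D \<subseteq> I \<Longrightarrow> i \<in> D \<Longrightarrow> i \<in> T D \<Longrightarrow> i \<in> S (D - {i})"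
    and S: "\<And>D. D \<subseteq> I \<Longrightarrow> S D \<subseteq> I"
    and hit: "\<And>D. D \<subseteq> I \<Longrightarrow> \<not> G D \<Longrightarrow> D \<inter> T D \<noteq> {}"
    and a: "0 \<le> a" "a + 1 \<le> (1 - p) / (2 * p)"
  shows "1 \<le> card I * (\<Sum>D\<in>Pow I. subset_weight p I D * (of_bool (G D) + of_bool (a \<le> card (S D))))"
proof -
  let ?w = "subset_weight p I"
  have w: "0 \<le> ?w D" for D using p by (intro subset_weight_nonneg) auto
  let ?g = "\<Sum>D\<in>Pow I. ?w D * of_bool (G D)"
  let ?s = "\<Sum>D\<in>Pow I. ?w D * of_bool (a \<le> card (S D))"
  have nonneg: "0 \<le> ?g" "0 \<le> ?s" using w by (auto intro!: sum_nonneg)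
  have "1 \<le> card I * (?g + ?s)"
  proof (cases "1 / 2 \<le> ?g")
    case True
    have "1 = 2 * (1 / 2 :: real)" by simp
    also have "\<dots> \<le> card I * (?g + ?s)"
      using I(2) True nonneg by (intro mult_mono) auto
    finally show ?thesis .
  next
    case False
    have "1 - ?g = (\<Sum>D\<in>Pow I. ?w D * (1 - of_bool (G D)))"
      by (simp add: right_diff_distrib sum_subtractf sum_subset_weight[OF I(1)])
    also have "\<dots> \<le> (\<Sum>D\<in>Pow I. ?w D * card (D \<inter> T D))"
    proof (rule sum_mono)
      fix D assume D: "D \<in> Pow I"
      then have fin: "finite (D \<inter> T D)" using I(1) finite_subset by blast
      have "1 - of_bool (G D) \<le> real (card (D \<inter> T D))"
        using hit[of D] D fin by (cases "G D") (auto simp: Suc_le_eq card_gt_0_iff)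
      then show "?w D * (1 - of_bool (G D)) \<le> ?w D * card (D \<inter> T D)"
        using w by (intro mult_left_mono) auto
    qed
    finally have "1 / 2 \<le> (\<Sum>D\<in>Pow I. ?w D * card (D \<inter> T D))" using False by simp
    then have "(1 - p) * (1 / 2) \<le> (1 - p) * (\<Sum>D\<in>Pow I. ?w D * card (D \<inter> T D))"
      using p by (intro mult_left_mono) auto
    also have "\<dots> \<le> p * (\<Sum>D\<in>Pow I. ?w D * card (S D))"
      using p by (intro sum_hit_le_sum_sensitive I edge S) auto
    finally have "(1 - p) / (2 * p) \<le> (\<Sum>D\<in>Pow I. ?w D * card (S D))"
      using p by (simp add: pos_divide_le_eq mult_ac)
    then have "a + 1 \<le> (\<Sum>D\<in>Pow I. ?w D * card (S D))" using a(2) by linarith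
    also have "\<dots> \<le> (\<Sum>D\<in>Pow I. ?w D * (a + real (card I) * of_bool (a \<le> card (S D))))"
    proof (rule sum_mono)
      fix D assume "D \<in> Pow I"
      then have "card (S D) \<le> card I" using S I(1) by (intro card_mono) auto
      then have "real (card (S D)) \<le> a + real (card I) * of_bool (a \<le> card (S D))"
        using a(1) by auto
      then show "?w D * card (S D) \<le> ?w D * (a + real (card I) * of_bool (a \<le> card (S D)))"
        using w by (intro mult_left_mono) auto
    qed
    also have "\<dots> = a * (\<Sum>D\<in>Pow I. ?w D) + card I * ?s"
      by (simp only: distrib_left sum.distrib sum_distrib_left mult_ac)
    finally have "1 \<le> card I * ?s" by (simp add: sum_subset_weight[OF I(1)])
    then show ?thesis using nonneg(1) by (simp add: distrib_left add_increasing)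
  qed
  then show ?thesis by (simp only: distrib_left sum.distrib)
qed

section \<open>Counting oracles as finite sets of bits, and reprogramming them\<close>

lemma sum_Pow_split:
  assumes "finite U" "B \<subseteq> U"
  shows "(\<Sum>T\<in>Pow U. f T) = (\<Sum>T0\<in>Pow (U - B). \<Sum>T1\<in>Pow B. f (T0 \<union> T1))"
  unfolding sum.cartesian_product
  by (rule sum.reindex_bij_witness[of _ "\<lambda>(T0, T1). T0 \<union> T1" "\<lambda>T. (T - B, T \<inter> B)"])
    (use assms in \<open>auto simp: Un_Diff_Int\<close>)

text \<open>A set \<open>T\<close> of bits stands for the oracle that is \<open>True\<close> on \<open>T\<close>; the factor \<open>1 - p\<close> is the probability that
  the block \<open>B\<close> is not all \<open>True\<close>.\<close>

lemma sum_Pow_fill_block: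
  fixes \<Phi> :: "'b set \<Rightarrow> real"
  assumes U: "finite U" "B \<subseteq> U" and p: "p = (1 / 2) ^ card B"
  shows "(\<Sum>T\<in>Pow U. of_bool (\<not> B \<subseteq> T) * ((1 - p) * \<Phi> T + p * \<Phi> (T \<union> B)))
    = (1 - p) * (\<Sum>T\<in>Pow U. \<Phi> T)"
proof -
  have finB: "finite B" using U finite_subset by blast
  have "(\<Sum>T1\<in>Pow B. of_bool (\<not> B \<subseteq> T0 \<union> T1) * ((1 - p) * \<Phi> (T0 \<union> T1) + p * \<Phi> (T0 \<union> T1 \<union> B)))
      = (1 - p) * (\<Sum>T1\<in>Pow B. \<Phi> (T0 \<union> T1))" if T0: "T0 \<in> Pow (U - B)" for T0
  proof -
    have "(\<Sum>T1\<in>Pow B. of_bool (\<not> B \<subseteq> T0 \<union> T1) * ((1 - p) * \<Phi> (T0 \<union> T1) + p * \<Phi> (T0 \<union> T1 \<union> B)))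
        = (\<Sum>T1\<in>Pow B - {B}. (1 - p) * \<Phi> (T0 \<union> T1) + p * \<Phi> (T0 \<union> B))"
    proof (rule sum.mono_neutral_cong_right)
      fix T1 assume "T1 \<in> Pow B - {B}"
      then have "\<not> B \<subseteq> T0 \<union> T1" "T0 \<union> T1 \<union> B = T0 \<union> B" using T0 by auto
      then show "of_bool (\<not> B \<subseteq> T0 \<union> T1) * ((1 - p) * \<Phi> (T0 \<union> T1) + p * \<Phi> (T0 \<union> T1 \<union> B))
          = (1 - p) * \<Phi> (T0 \<union> T1) + p * \<Phi> (T0 \<union> B)" by simp
    qed (use finB in auto)
    also have "\<dots> = (1 - p) * (\<Sum>T1\<in>Pow B - {B}. \<Phi> (T0 \<union> T1)) + (2 ^ card B - 1) * p * \<Phi> (T0 \<union> B)"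
      using finB by (simp add: sum.distrib sum_distrib_left card_Pow of_nat_diff)
    \<comment> \<open>Each of the 2^d - 1 settings of the block that are not full contributes p
      times the value at the full block. Together they restore the missing summand with weight 1 -
      p.\<close>
    also have "(2 ^ card B - 1) * p = 1 - p"
      by (simp add: p left_diff_distrib diff_divide_distrib power_divide)
    also have "(1 - p) * (\<Sum>T1\<in>Pow B - {B}. \<Phi> (T0 \<union> T1)) + (1 - p) * \<Phi> (T0 \<union> B)
        = (1 - p) * (\<Sum>T1\<in>Pow B. \<Phi> (T0 \<union> T1))"
      using finB sum.remove[of "Pow B" B "\<lambda>T1. \<Phi> (T0 \<union> T1)"] by (simp add: distrib_left)
    finally show ?thesis .
  qed
  then show ?thesis
    by (subst (1 2) sum_Pow_split[OF U]) (simp add: sum_distrib_left)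
qed

text \<open>An oracle with no full block, in which a p-random set of blocks is then filled, is
  distributed like a uniform oracle; (1 - p)^card I is the probability that no block is full. The
  induction treats one block at a time by \<open>sum_Pow_fill_block\<close>.\<close>

lemma sum_Pow_fill_blocks:
  fixes \<Phi> :: "'b set \<Rightarrow> real"
  assumes U: "finite U" and I: "finite I" and sub: "\<And>i. i \<in> I \<Longrightarrow> b i \<subseteq> U"
    and disj: "disjoint_family_on b I" and card: "\<And>i. i \<in> I \<Longrightarrow> card (b i) = d"
    and p: "p = (1 / 2) ^ d"
  shows "(\<Sum>T\<in>Pow U. of_bool (\<forall>i\<in>I. \<not> b i \<subseteq> T) * (\<Sum>D\<in>Pow I. subset_weight p I D * \<Phi> (T \<union> \<Union> (b ` D))))
    = (1 - p) ^ card I * (\<Sum>T\<in>Pow U. \<Phi> T)"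
  using I sub disj card
proof (induction I rule: finite_induct)
  case empty
  then show ?case by (simp add: subset_weight_def)
next
  case (insert j I)
  define \<Psi> where "\<Psi> T = of_bool (\<forall>i\<in>I. \<not> b i \<subseteq> T) *
    (\<Sum>D\<in>Pow I. subset_weight p I D * \<Phi> (T \<union> \<Union> (b ` D)))" for T
  have disj: "disjoint_family_on b I" and bj: "\<And>i. i \<in> I \<Longrightarrow> b i \<inter> b j = {}"
    using insert.prems(2) insert.hyps(2) by (auto simp: disjoint_family_on_def)
  have w: "subset_weight p (insert j I) D = (1 - p) * subset_weight p I D"
    "subset_weight p (insert j I) (insert j D) = p * subset_weight p I D" if "D \<in> Pow I" for D
  proof -
    have D: "finite D" "j \<notin> D" using that insert.hyps finite_subset by auto
    then have "insert j I - D = insert j (I - D)" "insert j I - insert j D = I - D"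
      using that insert.hyps by auto
    then show "subset_weight p (insert j I) D = (1 - p) * subset_weight p I D"
      "subset_weight p (insert j I) (insert j D) = p * subset_weight p I D"
      using D insert.hyps by (simp_all add: subset_weight_def)
  qed
  have split: "(\<Sum>D\<in>Pow (insert j I). subset_weight p (insert j I) D * \<Phi> (T \<union> \<Union> (b ` D)))
      = (1 - p) * (\<Sum>D\<in>Pow I. subset_weight p I D * \<Phi> (T \<union> \<Union> (b ` D)))
        + p * (\<Sum>D\<in>Pow I. subset_weight p I D * \<Phi> (T \<union> b j \<union> \<Union> (b ` D)))" for T
  proof -
    have "inj_on (insert j) (Pow I)" using insert.hyps(2) by (intro inj_onI) (metis Diff_insert_absorb Pow_iff subsetD)
    moreover have "Pow I \<inter> insert j ` Pow I = {}" using insert.hyps(2) by auto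
    moreover have "T \<union> \<Union> (b ` insert j D) = T \<union> b j \<union> \<Union> (b ` D)" for D by auto
    ultimately show ?thesis
      unfolding Pow_insert using insert.hyps(1)
      by (simp add: sum.union_disjoint sum.reindex w sum_distrib_left mult.assoc)
  qed
  have "of_bool (\<forall>i\<in>insert j I. \<not> b i \<subseteq> T) *
      (\<Sum>D\<in>Pow (insert j I). subset_weight p (insert j I) D * \<Phi> (T \<union> \<Union> (b ` D)))
      = of_bool (\<not> b j \<subseteq> T) * ((1 - p) * \<Psi> T + p * \<Psi> (T \<union> b j))" for T
  proof -
    \<comment> \<open>By disjointness, filling block j makes no other block full.\<close>
    have "(\<forall>i\<in>I. \<not> b i \<subseteq> T \<union> b j) \<longleftrightarrow> (\<forall>i\<in>I. \<not> b i \<subseteq> T)" using bj by blast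
    then show ?thesis by (simp add: split \<Psi>_def)
  qed
  then have "(\<Sum>T\<in>Pow U. of_bool (\<forall>i\<in>insert j I. \<not> b i \<subseteq> T) *
      (\<Sum>D\<in>Pow (insert j I). subset_weight p (insert j I) D * \<Phi> (T \<union> \<Union> (b ` D))))
      = (\<Sum>T\<in>Pow U. of_bool (\<not> b j \<subseteq> T) * ((1 - p) * \<Psi> T + p * \<Psi> (T \<union> b j)))" by simp
  also have "\<dots> = (1 - p) * (\<Sum>T\<in>Pow U. \<Psi> T)"
    using insert.prems p by (intro sum_Pow_fill_block U) auto
  also have "(\<Sum>T\<in>Pow U. \<Psi> T) = (1 - p) ^ card I * (\<Sum>T\<in>Pow U. \<Phi> T)"
    unfolding \<Psi>_def using insert.prems disj by (intro insert.IH) auto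
  finally show ?case using insert.hyps by simp
qed

text \<open>Reduces probabilities to counting: the event is a disjoint union of cylinders, one for
  each setting of the bits in U, all of measure 2^(- card U).\<close>

lemma prob_random_oracle:
  fixes P :: "oracle_fun \<Rightarrow> bool"
  assumes U: "finite U" and det: "\<And>F F'. (\<And>s. s \<in> U \<Longrightarrow> F s = F' s) \<Longrightarrow> P F = P F'"
  shows "measure random_oracle {F \<in> space random_oracle. P F}
    = (\<Sum>T\<in>Pow U. of_bool (P (\<lambda>s. s \<in> T))) / 2 ^ card U"
proof -
  interpret R: prob_space random_oracle by (rule prob_space_random_oracle)
  interpret product_prob_space "\<lambda>_ :: bool list \<times> nat. measure_pmf (pmf_of_set (UNIV :: bool set))" UNIV
    by unfold_locales
  define C where "C T = {F \<in> space random_oracle. \<forall>s\<in>U. F s = (s \<in> T)}" for T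
  have C_sets: "C T \<in> sets random_oracle" for T
    unfolding C_def by (rule finitely_determined_event[OF U]) auto
  have C_meas: "measure random_oracle (C T) = 1 / 2 ^ card U" for T
  proof -
    have "C T = prod_emb UNIV (\<lambda>_. measure_pmf (pmf_of_set (UNIV :: bool set))) U (\<Pi>\<^sub>E s\<in>U. {s \<in> T})"
      by (auto simp: C_def prod_emb_def space_PiM PiE_iff extensional_def restrict_def)
    then have "measure random_oracle (C T)
        = (\<Prod>s\<in>U. measure (measure_pmf (pmf_of_set (UNIV :: bool set))) {s \<in> T})"
      unfolding random_oracle_def using U by (simp add: measure_PiM_emb)
    also have "\<dots> = (\<Prod>s\<in>U. 1 / 2)" by (simp add: measure_pmf_single)
    finally show ?thesis by (simp add: power_divide)
  qed
  have "{F \<in> space random_oracle. P F} = (\<Union>T\<in>{T \<in> Pow U. P (\<lambda>s. s \<in> T)}. C T)"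
  proof (intro equalityI subsetI)
    fix F assume F: "F \<in> {F \<in> space random_oracle. P F}"
    have "P F = P (\<lambda>s. s \<in> {s \<in> U. F s})" by (rule det) auto
    then show "F \<in> (\<Union>T\<in>{T \<in> Pow U. P (\<lambda>s. s \<in> T)}. C T)"
      using F by (intro UN_I[of "{s \<in> U. F s}"]) (auto simp: C_def)
  next
    fix F assume "F \<in> (\<Union>T\<in>{T \<in> Pow U. P (\<lambda>s. s \<in> T)}. C T)"
    then obtain T where "P (\<lambda>s. s \<in> T)" "\<forall>s\<in>U. F s = (s \<in> T)" by (auto simp: C_def)
    then show "F \<in> {F \<in> space random_oracle. P F}" using det[of F "\<lambda>s. s \<in> T"] by auto
  qed
  also have "measure random_oracle \<dots> = (\<Sum>T\<in>{T \<in> Pow U. P (\<lambda>s. s \<in> T)}. measure random_oracle (C T))"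
  proof (rule R.finite_measure_finite_Union)
    show "disjoint_family_on C {T \<in> Pow U. P (\<lambda>s. s \<in> T)}"
      by (auto simp: disjoint_family_on_def C_def)
  qed (use U C_sets in auto)
  also have "\<dots> = (\<Sum>T\<in>Pow U. of_bool (P (\<lambda>s. s \<in> T)) / 2 ^ card U)"
    using U by (simp only: C_meas sum.inter_filter finite_Pow_iff) (intro sum.cong, auto)
  finally show ?thesis by (simp add: sum_divide_distrib)
qed

text \<open>The core estimate for one fixed output. For each oracle T on which the output is valid
  and likely, \<open>many_sensitive\<close> is applied to the random set D of points to be filled;
  summing over T, \<open>sum_Pow_fill_blocks\<close> turns the filled oracles into uniform ones at
  the cost (1 - p)^card I.\<close>

lemma good_output_count:
  fixes A :: "'p query_algorithm" and pt :: "nat \<Rightarrow> bool list" and \<epsilon> a p :: real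
  assumes A: "valid_algorithm A" and \<epsilon>: "0 < \<epsilon>"
    and I: "finite I" "2 \<le> card I" and pt: "inj_on pt I"
    and U: "finite U" "\<And>i. i \<in> I \<Longrightarrow> {pt i} \<times> {..<d} \<subseteq> U"
    and p: "p = (1 / 2) ^ d" "p < 1" and a: "0 \<le> a" "a + 1 \<le> (1 - p) / (2 * p)"
  defines "\<tau> \<equiv> \<epsilon> / (64 * (real (num_queries A) + 1) ^ 3 * card I)"
  shows "(\<Sum>T\<in>Pow U. of_bool ((\<forall>i\<in>I. \<not> {pt i} \<times> {..<d} \<subseteq> T) \<and>
      \<epsilon> \<le> pmf (output_pmf A (\<lambda>s. s \<in> T)) z))
    \<le> card I * (1 - p) ^ card I * (\<Sum>T\<in>Pow U. of_bool (\<epsilon> / 4 \<le> pmf (output_pmf A (\<lambda>s. s \<in> T)) z)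
      + of_bool (a \<le> card {i \<in> I. \<tau> \<le> query_weight A (\<lambda>s. s \<in> T) {pt i}}))"
proof -
  define b where "b i = {pt i} \<times> {..<d}" for i
  define r where "r = real (num_queries A) + 1"
  \<comment> \<open>With this threshold the error 8 r * card I * \<tau>' of the output comparison is
    \<epsilon> / 2. The smaller \<tau> = \<tau>' / (4 r^2) is what survives of it when one point is
    no longer filled.\<close>
  define \<tau>' where "\<tau>' = \<epsilon> / (16 * r * card I)"
  define F :: "(bool list \<times> nat) set \<Rightarrow> nat set \<Rightarrow> oracle_fun" where
    "F T D = (\<lambda>s. s \<in> T \<union> \<Union> (b ` D))" for T D
  define S where "S T D = {i \<in> I. \<tau> \<le> query_weight A (F T D) {pt i}}" for T D
  define S' where "S' T D = {i \<in> I. \<tau>' \<le> query_weight A (F T D) {pt i}}" for T D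
  define \<Phi> :: "(bool list \<times> nat) set \<Rightarrow> real" where
    "\<Phi> T = of_bool (\<epsilon> / 4 \<le> pmf (output_pmf A (\<lambda>s. s \<in> T)) z)
      + of_bool (a \<le> card {i \<in> I. \<tau> \<le> query_weight A (\<lambda>s. s \<in> T) {pt i}})" for T
  have p0: "0 < p" using p(1) by simp
  have r: "1 \<le> r" "real (num_queries A) \<le> r" by (simp_all add: r_def)
  have cardI: "0 < real (card I)" using I(2) by simp
  have tau: "\<tau>' = 4 * r\<^sup>2 * \<tau>"
  proof -
    have "\<tau> = \<epsilon> / (64 * r ^ 3 * card I)" by (simp only: \<tau>_def r_def)
    then show ?thesis
      using r cardI by (simp add: \<tau>'_def power2_eq_square power3_eq_cube field_simps)
  qed
  have edge: "i \<in> S T (D - {i})" if "D \<subseteq> I" "i \<in> D" "i \<in> S' T D" for T D i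
  proof -
    have "F T D (x, j) = F T (D - {i}) (x, j)" if "x \<notin> {pt i}" for x j
      using that by (auto simp: F_def b_def)
    then have "query_weight A (F T D) {pt i} \<le> 4 * (num_queries A)\<^sup>2 * query_weight A (F T (D - {i})) {pt i}"
      by (rule query_weight_hybrid[OF A])
    also have "\<dots> \<le> 4 * r\<^sup>2 * query_weight A (F T (D - {i})) {pt i}"
      using r by (intro mult_right_mono mult_left_mono power_mono) auto
    finally have "4 * r\<^sup>2 * \<tau> \<le> 4 * r\<^sup>2 * query_weight A (F T (D - {i})) {pt i}"
      using that(3) by (simp add: S'_def tau)
    then have "\<tau> \<le> query_weight A (F T (D - {i})) {pt i}"
      using r(1) by (simp add: mult_le_cancel_left)
    then show ?thesis using that by (auto simp: S_def)
  qed
  \<comment> \<open>If no filled point were heavy, filling D would lose too little: \<epsilon> would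
    be less than 2 * (\<epsilon> / 4) + \<epsilon> / 2.\<close>
  have hit: "D \<inter> S' T D \<noteq> {}"
    if large: "\<epsilon> \<le> pmf (output_pmf A (\<lambda>s. s \<in> T)) z" and D: "D \<subseteq> I"
      and small: "\<not> \<epsilon> / 4 \<le> pmf (output_pmf A (F T D)) z" for T D
  proof
    assume empty: "D \<inter> S' T D = {}"
    have finD: "finite D" using D I(1) finite_subset by blast
    have "query_weight A (F T D) (pt ` D) = (\<Sum>i\<in>D. query_weight A (F T D) {pt i})"
      using query_weight_sum[of "pt ` D"] finD inj_on_subset[OF pt D] by (simp add: sum.reindex)
    also have "\<dots> \<le> (\<Sum>i\<in>D. \<tau>')"
      using empty D by (intro sum_mono) (force simp: S'_def)
    also have "\<dots> = card D * \<tau>'" by simp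
    also have "\<dots> \<le> card I * \<tau>'"
      using card_mono[OF I(1) D] \<epsilon> r by (intro mult_right_mono) (simp_all add: \<tau>'_def)
    finally have W: "query_weight A (F T D) (pt ` D) \<le> card I * \<tau>'" .
    have agree: "(x, j) \<in> T \<longleftrightarrow> F T D (x, j)" if "x \<notin> pt ` D" for x j
      using that by (auto simp: F_def b_def)
    have "\<epsilon> \<le> pmf (output_pmf A (\<lambda>s. s \<in> T)) z" by (rule large)
    also have "\<dots> \<le> 2 * pmf (output_pmf A (F T D)) z
        + 8 * num_queries A * query_weight A (F T D) (pt ` D)"
      by (rule output_hybrid[OF A]) (rule agree)
    also have "8 * num_queries A * query_weight A (F T D) (pt ` D) \<le> 8 * r * (card I * \<tau>')"
      using r W by (intro mult_mono) auto
    also have "8 * r * (card I * \<tau>') = \<epsilon> / 2"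
      using r cardI by (simp add: \<tau>'_def)
    finally show False using small by simp
  qed
  have key: "of_bool ((\<forall>i\<in>I. \<not> b i \<subseteq> T) \<and> \<epsilon> \<le> pmf (output_pmf A (\<lambda>s. s \<in> T)) z)
      \<le> card I * (of_bool (\<forall>i\<in>I. \<not> b i \<subseteq> T) *
        (\<Sum>D\<in>Pow I. subset_weight p I D * \<Phi> (T \<union> \<Union> (b ` D))))" for T
  proof (cases "(\<forall>i\<in>I. \<not> b i \<subseteq> T) \<and> \<epsilon> \<le> pmf (output_pmf A (\<lambda>s. s \<in> T)) z")
    case True
    have "1 \<le> card I * (\<Sum>D\<in>Pow I. subset_weight p I D *
        (of_bool (\<epsilon> / 4 \<le> pmf (output_pmf A (F T D)) z) + of_bool (a \<le> card (S T D))))"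
      by (rule many_sensitive[OF I p0 p(2) _ _ _ a, where T = "S' T"])
        (use edge hit True in \<open>auto simp: S_def\<close>)
    also have "\<dots> = card I * (\<Sum>D\<in>Pow I. subset_weight p I D * \<Phi> (T \<union> \<Union> (b ` D)))"
      by (simp only: \<Phi>_def F_def S_def)
    finally show ?thesis using True by simp
  next
    case False
    then have "of_bool ((\<forall>i\<in>I. \<not> b i \<subseteq> T) \<and> \<epsilon> \<le> pmf (output_pmf A (\<lambda>s. s \<in> T)) z) = (0 :: real)"
      by simp
    also have "0 \<le> card I * (of_bool (\<forall>i\<in>I. \<not> b i \<subseteq> T) *
        (\<Sum>D\<in>Pow I. subset_weight p I D * \<Phi> (T \<union> \<Union> (b ` D))))"
      using p0 p(2) by (intro mult_nonneg_nonneg sum_nonneg subset_weight_nonneg) (auto simp: \<Phi>_def)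
    finally show ?thesis .
  qed
  have "(\<Sum>T\<in>Pow U. of_bool ((\<forall>i\<in>I. \<not> b i \<subseteq> T) \<and> \<epsilon> \<le> pmf (output_pmf A (\<lambda>s. s \<in> T)) z))
      \<le> (\<Sum>T\<in>Pow U. card I * (of_bool (\<forall>i\<in>I. \<not> b i \<subseteq> T) *
        (\<Sum>D\<in>Pow I. subset_weight p I D * \<Phi> (T \<union> \<Union> (b ` D)))))"
    by (rule sum_mono) (rule key)
  also have "\<dots> = card I * ((1 - p) ^ card I * (\<Sum>T\<in>Pow U. \<Phi> T))"
  proof -
    have "(\<Sum>T\<in>Pow U. of_bool (\<forall>i\<in>I. \<not> b i \<subseteq> T) *
        (\<Sum>D\<in>Pow I. subset_weight p I D * \<Phi> (T \<union> \<Union> (b ` D)))) = (1 - p) ^ card I * (\<Sum>T\<in>Pow U. \<Phi> T)"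
      by (rule sum_Pow_fill_blocks[OF U(1) I(1) _ _ _ p(1)])
        (use U(2) pt in \<open>auto simp: b_def disjoint_family_on_def inj_on_def\<close>)
    then show ?thesis by (simp only: sum_distrib_left[symmetric])
  qed
  finally show ?thesis by (simp only: b_def \<Phi>_def mult.assoc)
qed

section \<open>From one codeword to the whole code\<close>

lemma biased_oracle_iff:
  "biased_oracle enc l (\<lambda>s. s \<in> T) i x \<longleftrightarrow> {enc (i, x)} \<times> {..<par_d l} \<subseteq> T"
  by (auto simp: biased_oracle_def answer_def list_eq_iff_nth_eq)

lemma pmf_Some_count:
  fixes D :: "'b option pmf"
  assumes "0 < \<epsilon>" "finite C"
  shows "(\<Sum>x\<in>C. of_bool (\<epsilon> \<le> pmf D (Some x))) \<le> 1 / (\<epsilon> :: real)"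
proof -
  have "\<epsilon> * (\<Sum>x\<in>C. of_bool (\<epsilon> \<le> pmf D (Some x))) \<le> (\<Sum>x\<in>C. pmf D (Some x))"
    unfolding sum_distrib_left by (intro sum_mono) auto
  also have "\<dots> = measure_pmf.prob D (Some ` C)"
    using assms(2) by (subst measure_measure_pmf_finite) (auto simp: sum.reindex)
  also have "\<dots> \<le> 1" by simp
  finally show ?thesis using assms(1) by (simp add: field_simps)
qed

text \<open>The bits the algorithm can query, together with those on which validity of the codewords
  depends, decide the event. This gives measurability and allows counting.\<close>

lemma good_output_determined:
  fixes A :: "'a list list query_algorithm" and F F' :: oracle_fun
  assumes C: "\<And>xs i. xs \<in> C \<Longrightarrow> i \<in> {1..par_n l} \<Longrightarrow> xs ! (i - 1) \<in> \<Sigma>"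
    and F: "\<And>s. s \<in> {x. length x \<le> in_len A} \<times> {..<out_len A} \<union>
      (enc ` ({1..par_n l} \<times> \<Sigma>)) \<times> {..<par_d l} \<Longrightarrow> F s = F' s"
  shows "(\<exists>xs\<in>C. (\<forall>i\<in>{1..par_n l}. \<not> biased_oracle enc l F i (xs ! (i - 1))) \<and>
      \<epsilon> \<le> pmf (output_pmf A F) (Some xs)) \<longleftrightarrow>
    (\<exists>xs\<in>C. (\<forall>i\<in>{1..par_n l}. \<not> biased_oracle enc l F' i (xs ! (i - 1))) \<and>
      \<epsilon> \<le> pmf (output_pmf A F') (Some xs))"
proof -
  have "state_after A F (num_queries A) = state_after A F' (num_queries A)"
    using F by (intro state_after_cong) auto
  then have "output_pmf A F = output_pmf A F'"
    by (simp add: output_pmf_def measurement_pmf_def cong: if_cong)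
  moreover have "biased_oracle enc l F i (xs ! (i - 1)) = biased_oracle enc l F' i (xs ! (i - 1))"
    if "xs \<in> C" "i \<in> {1..par_n l}" for xs i
  proof -
    have "F (enc (i, xs ! (i - 1)), j) = F' (enc (i, xs ! (i - 1)), j)" if "j < par_d l" for j
      using C[OF \<open>xs \<in> C\<close> \<open>i \<in> {1..par_n l}\<close>] \<open>i \<in> {1..par_n l}\<close> that by (intro F) blast
    then have "answer F (enc (i, xs ! (i - 1))) (par_d l) = answer F' (enc (i, xs ! (i - 1))) (par_d l)"
      unfolding answer_def by (intro map_cong refl) simp
    then show ?thesis by (simp add: biased_oracle_def)
  qed
  ultimately show ?thesis by simp
qed

text \<open>A union bound over the codewords with \<open>good_output_count\<close>. After exchanging
  sums, two counts remain for each oracle: codewords output with probability at least \<epsilon> /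
  4, at most 4 / \<epsilon> of them, and codewords with at least a heavy coordinates, at most L by
  list recovery.\<close>

lemma prob_good_output_le:
  fixes A :: "'a list list query_algorithm" and C :: "'a list list set" and \<Sigma> :: "'a list set"
    and \<epsilon> a p L :: real and enc :: "nat \<times> 'a list \<Rightarrow> bool list"
  assumes A: "valid_algorithm A" and \<epsilon>: "0 < \<epsilon>" and n: "2 \<le> par_n l"
    and \<Sigma>: "finite \<Sigma>" and enc: "inj_on enc ({1..par_n l} \<times> \<Sigma>)"
    and C: "finite C" "\<And>xs i. xs \<in> C \<Longrightarrow> i \<in> {1..par_n l} \<Longrightarrow> xs ! (i - 1) \<in> \<Sigma>"
    and p: "p = (1 / 2) ^ par_d l" "p < 1" and a: "0 \<le> a" "a + 1 \<le> (1 - p) / (2 * p)"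
    and L: "\<And>S. S \<subseteq> {1..par_n l} \<times> \<Sigma> \<Longrightarrow>
      card S * \<epsilon> \<le> 64 * (real (num_queries A) + 1) ^ 4 * par_n l \<Longrightarrow>
      card {xs \<in> C. a \<le> card {i \<in> {1..par_n l}. (i, xs ! (i - 1)) \<in> S}} \<le> L"
  shows "measure random_oracle {F \<in> space random_oracle. \<exists>xs\<in>C.
      (\<forall>i\<in>{1..par_n l}. \<not> biased_oracle enc l F i (xs ! (i - 1))) \<and>
      \<epsilon> \<le> pmf (output_pmf A F) (Some xs)}
    \<le> par_n l * (1 - p) ^ par_n l * (4 / \<epsilon> + L)"
proof -
  define n where "n = par_n l"
  define I where "I = {1..n}"
  define d where "d = par_d l"
  define U where "U = {x. length x \<le> in_len A} \<times> {..<out_len A} \<union> (enc ` (I \<times> \<Sigma>)) \<times> {..<d}"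
  define \<tau> where "\<tau> = \<epsilon> / (64 * (real (num_queries A) + 1) ^ 3 * card I)"
  \<comment> \<open>Heavy pairs are collected over all coordinates and symbols, so the set depends
    on the oracle and not on the codeword.\<close>
  define H where "H T = {(i, x). (i, x) \<in> I \<times> \<Sigma> \<and> \<tau> \<le> query_weight A (\<lambda>s. s \<in> T) {enc (i, x)}}" for T
  have finU: "finite U"
    using \<Sigma> finite_lists_length_le[of "UNIV :: bool set" "in_len A"] by (simp add: U_def I_def)
  have cardI: "card I = n" "finite I" by (simp_all add: I_def)
  have tau: "0 < \<tau>" using \<epsilon> n by (simp add: \<tau>_def cardI n_def)
  let ?Good = "\<lambda>F xs. (\<forall>i\<in>I. \<not> biased_oracle enc l F i (xs ! (i - 1))) \<and> \<epsilon> \<le> pmf (output_pmf A F) (Some xs)"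
  let ?P = "\<lambda>T xs. pmf (output_pmf A (\<lambda>s. s \<in> T)) (Some xs)"
  have det: "(\<exists>xs\<in>C. ?Good F xs) = (\<exists>xs\<in>C. ?Good F' xs)" if "\<And>s. s \<in> U \<Longrightarrow> F s = F' s" for F F'
    unfolding I_def n_def
    by (rule good_output_determined[OF C(2)]) (use that in \<open>simp_all add: U_def I_def n_def d_def\<close>)
  have "measure random_oracle {F \<in> space random_oracle. \<exists>xs\<in>C. ?Good F xs}
      = (\<Sum>T\<in>Pow U. of_bool (\<exists>xs\<in>C. ?Good (\<lambda>s. s \<in> T) xs)) / 2 ^ card U"
    by (rule prob_random_oracle[OF finU]) (rule det)
  then have "measure random_oracle {F \<in> space random_oracle. \<exists>xs\<in>C. ?Good F xs} * 2 ^ card U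
      = (\<Sum>T\<in>Pow U. of_bool (\<exists>xs\<in>C. ?Good (\<lambda>s. s \<in> T) xs))" by (simp only:) simp
  also have "\<dots> \<le> (\<Sum>T\<in>Pow U. \<Sum>xs\<in>C. of_bool (?Good (\<lambda>s. s \<in> T) xs))"
  proof (rule sum_mono)
    fix T
    show "of_bool (\<exists>xs\<in>C. ?Good (\<lambda>s. s \<in> T) xs) \<le> (\<Sum>xs\<in>C. of_bool (?Good (\<lambda>s. s \<in> T) xs) :: real)"
    proof (cases "\<exists>xs\<in>C. ?Good (\<lambda>s. s \<in> T) xs")
      case True
      then obtain xs where "xs \<in> C" "?Good (\<lambda>s. s \<in> T) xs" by blast
      then show ?thesis
        using member_le_sum[of xs C "\<lambda>xs. of_bool (?Good (\<lambda>s. s \<in> T) xs) :: real"] C(1) by auto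
    qed (auto intro: sum_nonneg)
  qed
  also have "\<dots> = (\<Sum>xs\<in>C. \<Sum>T\<in>Pow U. of_bool (?Good (\<lambda>s. s \<in> T) xs))" by (rule sum.swap)
  also have "\<dots> \<le> (\<Sum>xs\<in>C. n * (1 - p) ^ n * (\<Sum>T\<in>Pow U. of_bool (\<epsilon> / 4 \<le> ?P T xs)
      + of_bool (a \<le> card {i \<in> I. (i, xs ! (i - 1)) \<in> H T})))"
  proof (rule sum_mono)
    fix xs assume xs: "xs \<in> C"
    define pt where "pt i = enc (i, xs ! (i - 1))" for i
    have mem: "(i, xs ! (i - 1)) \<in> I \<times> \<Sigma>" if "i \<in> I" for i
      using C(2)[OF xs, of i] that by (simp add: I_def n_def)
    have inj: "inj_on pt I"
    proof (rule inj_onI)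
      fix i j assume ij: "i \<in> I" "j \<in> I" "pt i = pt j"
      have "(i, xs ! (i - 1)) = (j, xs ! (j - 1))"
        by (rule inj_onD[OF enc]) (use ij mem in \<open>simp_all add: pt_def I_def n_def\<close>)
      then show "i = j" by simp
    qed
    have heavy: "{i \<in> I. \<tau> \<le> query_weight A (\<lambda>s. s \<in> T) {pt i}} = {i \<in> I. (i, xs ! (i - 1)) \<in> H T}" for T
      using mem by (auto simp: H_def pt_def)
    have "(\<Sum>T\<in>Pow U. of_bool (?Good (\<lambda>s. s \<in> T) xs))
        = (\<Sum>T\<in>Pow U. of_bool ((\<forall>i\<in>I. \<not> {pt i} \<times> {..<d} \<subseteq> T) \<and> \<epsilon> \<le> ?P T xs) :: real)"
      by (simp only: biased_oracle_iff pt_def d_def)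
    also have "\<dots> \<le> card I * (1 - p) ^ card I * (\<Sum>T\<in>Pow U. of_bool (\<epsilon> / 4 \<le> ?P T xs)
        + of_bool (a \<le> card {i \<in> I. \<tau> \<le> query_weight A (\<lambda>s. s \<in> T) {pt i}}))"
      unfolding \<tau>_def
    proof (rule good_output_count[OF A \<epsilon> cardI(2) _ inj finU _ _ p(2) a])
      show "{pt i} \<times> {..<d} \<subseteq> U" if "i \<in> I" for i
        using mem[OF that] unfolding pt_def U_def by blast
    qed (use p n in \<open>simp_all add: d_def cardI n_def\<close>)
    finally show "(\<Sum>T\<in>Pow U. of_bool (?Good (\<lambda>s. s \<in> T) xs)) \<le> n * (1 - p) ^ n *
        (\<Sum>T\<in>Pow U. of_bool (\<epsilon> / 4 \<le> ?P T xs) + of_bool (a \<le> card {i \<in> I. (i, xs ! (i - 1)) \<in> H T}))"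
      by (simp only: cardI heavy)
  qed
  also have "\<dots> = n * (1 - p) ^ n * (\<Sum>T\<in>Pow U. (\<Sum>xs\<in>C. of_bool (\<epsilon> / 4 \<le> ?P T xs))
      + (\<Sum>xs\<in>C. of_bool (a \<le> card {i \<in> I. (i, xs ! (i - 1)) \<in> H T})))"
    unfolding sum_distrib_left[symmetric] by (subst sum.swap) (simp only: sum.distrib)
  also have "\<dots> \<le> n * (1 - p) ^ n * (\<Sum>T\<in>Pow U. 4 / \<epsilon> + L)"
  proof (intro mult_left_mono sum_mono add_mono)
    fix T
    show "(\<Sum>xs\<in>C. of_bool (\<epsilon> / 4 \<le> ?P T xs)) \<le> 4 / \<epsilon>"
      using pmf_Some_count[of "\<epsilon> / 4" C "output_pmf A (\<lambda>s. s \<in> T)"] \<epsilon> C(1) by simp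
    have HI: "H T \<subseteq> I \<times> \<Sigma>" by (auto simp: H_def)
    have inj: "inj_on enc (H T)" using inj_on_subset[OF enc] HI by (simp add: I_def n_def)
    have finH: "finite (H T)" using HI \<Sigma> cardI(2) finite_subset by blast
    have "card (enc ` H T) * \<tau> \<le> num_queries A"
      by (rule card_heavy_le[OF A _ tau]) (use finH in \<open>auto simp: H_def\<close>)
    then have *: "card (H T) * \<tau> \<le> real (num_queries A) + 1" by (simp add: card_image[OF inj])
    define r where "r = real (num_queries A) + 1"
    have r: "0 < r" by (simp add: r_def add_nonneg_pos)
    \<comment> \<open>The heavy points share a total weight of at most Q \<le> r; inserting \<tau>
      gives the size bound under which \<open>L\<close> applies.\<close>
    have "card (H T) * \<epsilon> / (64 * r ^ 3 * par_n l) \<le> r"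
      using * by (simp only: \<tau>_def cardI n_def r_def times_divide_eq_right)
    then have "card (H T) * \<epsilon> \<le> r * (64 * r ^ 3 * par_n l)"
      using n r by (subst (asm) pos_divide_le_eq) auto
    then have "card (H T) * \<epsilon> \<le> 64 * r ^ 4 * par_n l"
      by (simp add: power4_eq_xxxx power3_eq_cube mult_ac)
    then have "card (H T) * \<epsilon> \<le> 64 * (real (num_queries A) + 1) ^ 4 * par_n l" by (simp only: r_def)
    then have "card {xs \<in> C. a \<le> card {i \<in> I. (i, xs ! (i - 1)) \<in> H T}} \<le> L"
      using HI unfolding I_def n_def by (intro L)
    then show "(\<Sum>xs\<in>C. of_bool (a \<le> card {i \<in> I. (i, xs ! (i - 1)) \<in> H T})) \<le> L"
      using sum.inter_filter[OF C(1), of "\<lambda>_. 1 :: real" "\<lambda>xs. a \<le> card {i \<in> I. (i, xs ! (i - 1)) \<in> H T}"]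
      by (simp add: of_bool_def)
  qed (use p in auto)
  also have "\<dots> = n * (1 - p) ^ n * (4 / \<epsilon> + L) * 2 ^ card U"
    using finU by (simp add: card_Pow)
  finally show ?thesis by (simp add: n_def I_def)
qed

section \<open>Parameters and asymptotics\<close>

text \<open>Finite support makes the supremum a maximum, attained at an outcome of positive
  probability.\<close>

lemma min_entropy_le_imp_pmf_ge:
  assumes "finite (set_pmf D)" and "min_entropy D \<le> h"
  obtains z where "z \<in> set_pmf D" "2 powr (- h) \<le> pmf D z"
proof -
  obtain y where y: "y \<in> set_pmf D" using set_pmf_not_empty[of D] by blast
  have "range (pmf D) \<subseteq> insert 0 (pmf D ` set_pmf D)" by (auto simp: set_pmf_iff)
  then have fin: "finite (range (pmf D))" using assms(1) finite_subset by blast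
  then have "(SUP z. pmf D z) = Max (range (pmf D))" by (intro cSup_eq_Max) auto
  moreover have "Max (range (pmf D)) \<in> range (pmf D)" using fin by (intro Max_in) auto
  ultimately obtain z where z: "(SUP z. pmf D z) = pmf D z" by auto
  have "pmf D y \<le> pmf D z" unfolding z[symmetric] using fin by (intro cSup_upper bdd_above_finite) auto
  then have pos: "0 < pmf D z" using y pmf_positive[of y D] by linarith
  have "- h \<le> log 2 (pmf D z)" using assms(2) by (simp add: min_entropy_def z)
  then have "2 powr (- h) \<le> pmf D z" using pos by (simp add: le_log_iff)
  then show thesis using pos by (intro that[of z]) (auto simp: set_pmf_iff)
qed

text \<open>Some accepted outcome has conditional probability at least 2^(-b); multiplying by the
  acceptance probability removes the conditioning. The verifier returns only its own input, so the
  bound carries over to the raw output.\<close>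

lemma low_entropy_imp_good_output:
  fixes A :: "'a list list query_algorithm"
  assumes A: "valid_algorithm A" and \<delta>: "0 < \<delta>"
    and acc: "\<delta> \<le> accept_prob (frs_verify K g enc) F l h A"
    and ent: "min_entropy (accepted_pmf (frs_verify K g enc) F l h A) \<le> b"
  shows "\<exists>xs\<in>frs_code (K l) (g l) l. (\<forall>i\<in>{1..par_n l}. \<not> biased_oracle (enc l) l F i (xs ! (i - 1))) \<and>
    \<delta> * 2 powr (- b) \<le> pmf (output_pmf A F) (Some xs)"
proof -
  let ?V = "frs_verify K g enc F l h"
  define N where "N = {z :: 'a list list option. z \<noteq> None}"
  define D where "D = verified_pmf (frs_verify K g enc) F l h A"
  define p where "p = measure_pmf.prob D N"
  have p: "\<delta> \<le> p" using acc by (simp add: accept_prob_def D_def p_def N_def)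
  then have ne: "set_pmf D \<inter> N \<noteq> {}"
    using \<delta> measure_Int_set_pmf[of D "N"] by (force simp: p_def Int_commute)
  have "set_pmf (measurement_pmf A F) \<subseteq> labels A"
    using pmf_measurement_pmf[OF A, of F] by (auto simp: set_pmf_iff split: if_splits)
  then have "finite (set_pmf D)"
    unfolding D_def verified_pmf_def output_pmf_def using finite_subset by fastforce
  then have "finite (set_pmf (cond_pmf D N))" by (simp add: set_cond_pmf[OF ne])
  then obtain z where z: "z \<in> set_pmf (cond_pmf D N)" "2 powr (- b) \<le> pmf (cond_pmf D N) z"
    using ent unfolding accepted_pmf_def D_def[symmetric] N_def[symmetric] by (rule min_entropy_le_imp_pmf_ge)
  have "z \<in> set_pmf D \<inter> N" using z(1) by (simp only: set_cond_pmf[OF ne])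
  then obtain xs where xs: "z = Some xs" "Some xs \<in> set_pmf D" by (auto simp: N_def)
  have "2 powr (- b) \<le> pmf D (Some xs) / p" using z(2) by (simp add: pmf_cond[OF ne] xs p_def N_def[THEN eqset_imp_iff])
  then have "p * 2 powr (- b) \<le> pmf D (Some xs)" using p \<delta> by (simp add: pos_le_divide_eq mult.commute)
  moreover have "\<delta> * 2 powr (- b) \<le> p * 2 powr (- b)" using p by (intro mult_right_mono) auto
  ultimately have "\<delta> * 2 powr (- b) \<le> pmf D (Some xs)" by linarith
  also have "pmf D (Some xs) = measure_pmf.prob (output_pmf A F) (?V -` {Some xs})"
    by (simp add: D_def verified_pmf_def pmf_map)
  also have "\<dots> \<le> measure_pmf.prob (output_pmf A F) {Some xs}"
    by (intro measure_pmf.finite_measure_mono) (auto simp: frs_verify_def split: option.splits if_splits)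
  also have "\<dots> = pmf (output_pmf A F) (Some xs)" by (simp add: measure_pmf_single)
  finally have *: "\<delta> * 2 powr (- b) \<le> pmf (output_pmf A F) (Some xs)" .
  obtain pf where "?V pf = Some xs"
    using xs(2) by (auto simp: D_def verified_pmf_def)
  then have "xs \<in> frs_code (K l) (g l) l \<and> (\<forall>i\<in>{1..par_n l}. \<not> biased_oracle (enc l) l F i (xs ! (i - 1)))"
    by (auto simp: frs_verify_def split: option.splits if_splits)
  with * show ?thesis by blast
qed

section \<open>Concrete parameters\<close>

lemma bias_bounds:
  assumes "0 < par_n l"
  shows "1 / (80 * sqrt (par_n l)) < (1 / 2 :: real) ^ par_d l" "(1 / 2 :: real) ^ par_d l \<le> 1 / (40 * sqrt (par_n l))"
  using theI'[OF par_d_unique[OF assms]] unfolding par_d_def by auto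

text \<open>The bias has order 1 / sqrt n. Its upper bound leaves room for 10 * sqrt n heavy
  coordinates; its lower bound gives (1 - p)^n \<le> exp(- p n), exponentially small in sqrt
  n.\<close>

lemma bias_consequences:
  assumes n: "0 < par_n l"
  defines "p \<equiv> (1 / 2 :: real) ^ par_d l"
  shows "p < 1" "10 * sqrt (par_n l) + 1 \<le> (1 - p) / (2 * p)"
    "(1 - p) ^ par_n l \<le> exp (- sqrt (par_n l) / 80)"
proof -
  define r where "r = sqrt (par_n l)"
  have r: "1 \<le> r" "r * r = par_n l" using n by (simp_all add: r_def)
  have p: "0 < p" "1 / (80 * r) < p" "p \<le> 1 / (40 * r)"
    using bias_bounds[OF n] by (simp_all add: p_def r_def)
  have "1 / (40 * r) < 1" using r(1) by (simp add: divide_less_eq)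
  then show p1: "p < 1" using p(3) by simp
  have "40 * r \<le> 1 / p" using p(1,3) r(1) by (simp add: field_simps)
  define u where "u = 1 / p"
  have "10 * r + 1 \<le> u / 2 - 1 / 2" using \<open>40 * r \<le> 1 / p\<close> r(1) unfolding u_def[symmetric] by linarith
  also have "\<dots> = (1 - p) / (2 * p)" using p(1) by (simp add: u_def field_simps)
  finally show "10 * sqrt (par_n l) + 1 \<le> (1 - p) / (2 * p)" by (simp add: r_def)
  have "1 - p \<le> exp (- p)" using exp_ge_add_one_self[of "- p"] by simp
  then have "(1 - p) ^ par_n l \<le> exp (- p) ^ par_n l" using p1 by (intro power_mono) auto
  also have "\<dots> = exp (- (p * par_n l))" by (simp add: mult.commute flip: exp_of_nat_mult)
  also have "\<dots> \<le> exp (- r / 80)"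
  proof -
    have "1 / (80 * r) * (r * r) \<le> p * (r * r)" using p(2) r(1) by (intro mult_right_mono) auto
    moreover have "1 / (80 * r) * (r * r) = r / 80" using r(1) by simp
    ultimately show ?thesis using r(2) by simp
  qed
  finally show "(1 - p) ^ par_n l \<le> exp (- sqrt (par_n l) / 80)" by (simp add: r_def)
qed

text \<open>The choice of rate in the form that compares the degree k with the nm evaluation
  points.\<close>

lemma par_k_le: "10 * sqrt (par_n l) * par_k l \<le> par_n l * par_m l"
proof (cases "par_n l = 0")
  case False
  have "real (par_k l) \<le> par_R l * par_N l" by (simp add: par_k_def par_R_def)
  then have "10 * sqrt (par_n l) * par_k l \<le> 10 * sqrt (par_n l) * (par_R l * par_N l)"
    by (intro mult_left_mono) auto
  also have "\<dots> = par_N l" using False by (simp add: par_R_def)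
  also have "par_N l = par_n l * par_m l" by (simp add: par_N_def par_n_mult_par_m)
  finally show ?thesis .
qed simp

context finite_field_generator begin

lemma codeword_symbol:
  assumes "xs \<in> frs_code K \<gamma> l" "j < par_n l"
  shows "xs ! j \<in> alphabet K l"
proof -
  obtain f where f: "xs = codeword K \<gamma> l f" "set f \<subseteq> carrier K"
    using assms(1) by (auto simp: frs_code_def univ_poly_def polynomial_def)
  show ?thesis
    unfolding f(1) alphabet_def using assms(2) f(2)
    by (auto simp: codeword_def simp del: upt_Suc intro!: eval_in_carrier)
qed

lemma finite_frs_code: "finite (frs_code K \<gamma> l)"
proof (rule finite_subset)
  show "frs_code K \<gamma> l \<subseteq> {xs. set xs \<subseteq> alphabet K l \<and> length xs = par_n l}"
  proof
    fix xs assume xs: "xs \<in> frs_code K \<gamma> l"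
    then have "length xs = par_n l" by (auto simp: frs_code_def codeword_def)
    then show "xs \<in> {xs. set xs \<subseteq> alphabet K l \<and> length xs = par_n l}"
      using codeword_symbol[OF xs] by (auto simp: in_set_conv_nth)
  qed
  show "finite {xs. set xs \<subseteq> alphabet K l \<and> length xs = par_n l}"
    by (rule finite_lists_length_eq[OF finite_alphabet])
qed

text \<open>List recovery with b = 32 and r = s. The count holds as 8^s * 4^s = 32^s. For the
  degrees, 4 s \<le> m leaves at least 3/4 m window positions, and after multiplying by 10 * sqrt n
  the comparison is between (b - 1) nm = 31 nm and 10 * 10 * 3/4 nm = 75 nm.\<close>

lemma frs_list_size:
  assumes q: "q = par_q l" "32 \<le> q" and s: "0 < s" "4 * s \<le> par_m l"
    and S: "S \<subseteq> {1..par_n l} \<times> alphabet K l" "card S * par_m l < 8 ^ s"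
  shows "card {xs \<in> frs_code K \<gamma> l. 10 * sqrt (par_n l) \<le>
    card {i \<in> {1..par_n l}. (i, xs ! (i - 1)) \<in> S}} \<le> q ^ s"
proof -
  define A where "A = nat \<lceil>10 * sqrt (par_n l)\<rceil>"
  have A: "10 * sqrt (par_n l) \<le> A" "A \<le> k \<longleftrightarrow> 10 * sqrt (par_n l) \<le> k" for k
    by (simp_all add: A_def nat_le_iff ceiling_le_iff real_nat_ceiling_ge)
  have n: "0 < par_n l" using par_n_mult_par_m[of l] q by (cases "par_n l") auto
  have m: "0 < par_m l" by (simp add: par_m_def)
  let ?r = "sqrt (par_n l)"
  have r: "1 \<le> ?r" "?r * ?r = par_n l" using n by simp_all
  have "10 * ?r * (31 * par_k l) = 31 * (10 * ?r * par_k l)" by simp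
  also have "\<dots> \<le> 31 * real (par_n l * par_m l)" by (intro mult_left_mono par_k_le) simp
  also have "\<dots> < 75 * real (par_n l * par_m l)" using n m by simp
  also have "\<dots> = 10 * ?r * (10 * ?r * (3 / 4 * par_m l))" using r(2) by (simp add: algebra_simps)
  finally have "31 * par_k l < 10 * ?r * (3 / 4 * par_m l)"
    using r(1) by (subst (asm) mult_less_cancel_left_pos) auto
  also have "\<dots> \<le> A * real (par_m l + 1 - s)"
  proof (rule mult_mono)
    show "3 / 4 * real (par_m l) \<le> real (par_m l + 1 - s)" using s by (simp add: of_nat_diff)
  qed (use A in auto)
  finally have "31 * par_k l < A * (par_m l + 1 - s)"
    by (metis of_nat_less_iff of_nat_mult of_nat_numeral)
  then have deg: "s * (32 - 1) * par_k l < s * (A * (par_m l + 1 - s))" using s(1) by simp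
  have "2 ^ (s + s) = (4 :: nat) ^ s" by (simp add: power_add power_mult_distrib[symmetric])
  then have "card S * par_m l * 2 ^ (s + s) < 8 ^ s * 4 ^ s"
    using S(2) by simp
  then have count: "card S * par_m l * 2 ^ (s + s) < 32 ^ s"
    by (simp add: power_mult_distrib[symmetric])
  have "finite {xs \<in> frs_code K \<gamma> l. A \<le> card {i \<in> {1..par_n l}. (i, xs ! (i - 1)) \<in> S}} \<and>
      card {xs \<in> frs_code K \<gamma> l. A \<le> card {i \<in> {1..par_n l}. (i, xs ! (i - 1)) \<in> S}} \<le> q ^ s"
    by (rule frs_list_recovery[OF q(1) S(1) s(1) _ q(2) count deg]) (use s in auto)
  then show ?thesis by (simp only: A(2))
qed

end

text \<open>The bound for a single \<lambda>: \<open>prob_good_output_le\<close> with a = 10 * sqrt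
  n and L = q^s. The assumption \<open>heavy\<close> keeps the set of heavy points small enough for
  list recovery with windows of length s.\<close>

lemma prob_low_entropy_le:
  fixes A :: "'a list list query_algorithm" and K :: "nat \<Rightarrow> 'a ring"
  assumes A: "valid_algorithm A" and K: "finite_field_generator (K l) (g l) (par_q l)"
    and enc: "inj_on (enc l) ({1..par_n l} \<times> alphabet (K l) l)"
    and l: "2 \<le> par_n l" "32 \<le> par_q l" and \<delta>: "0 < \<delta>" and s: "0 < s" "4 * s \<le> par_m l"
    and heavy: "64 * (real (num_queries A) + 1) ^ 4 * par_n l * par_m l < 8 ^ s * (\<delta> * 2 powr - b)"
  shows "measure random_oracle {F \<in> space random_oracle.
      \<delta> \<le> accept_prob (frs_verify K g enc) F l h A \<and>
      min_entropy (accepted_pmf (frs_verify K g enc) F l h A) \<le> b}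
    \<le> par_n l * exp (- sqrt (par_n l) / 80) * (4 / (\<delta> * 2 powr - b) + real (par_q l) ^ s)"
proof -
  interpret K: finite_field_generator "K l" "g l" "par_q l" by (rule K)
  interpret R: prob_space random_oracle by (rule prob_space_random_oracle)
  define \<epsilon> where "\<epsilon> = \<delta> * 2 powr - b"
  define p :: real where "p = (1 / 2) ^ par_d l"
  let ?C = "frs_code (K l) (g l) l" and ?\<Sigma> = "alphabet (K l) l"
  have eps: "0 < \<epsilon>" using \<delta> by (simp add: \<epsilon>_def)
  have n: "0 < par_n l" using l by simp
  have p: "p < 1" "10 * sqrt (par_n l) + 1 \<le> (1 - p) / (2 * p)" "(1 - p) ^ par_n l \<le> exp (- sqrt (par_n l) / 80)"
    unfolding p_def by (rule bias_consequences[OF n])+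
  have symbol: "xs ! (i - 1) \<in> ?\<Sigma>" if "xs \<in> ?C" "i \<in> {1..par_n l}" for xs i
    using that by (intro K.codeword_symbol) auto
  let ?bad = "\<lambda>F. \<exists>xs\<in>?C. (\<forall>i\<in>{1..par_n l}. \<not> biased_oracle (enc l) l F i (xs ! (i - 1))) \<and>
      \<epsilon> \<le> pmf (output_pmf A F) (Some xs)"
  have bad_sets: "{F \<in> space random_oracle. ?bad F} \<in> sets random_oracle"
  proof (rule finitely_determined_event)
    define U where "U = {x. length x \<le> in_len A} \<times> {..<out_len A} \<union>
      (enc l ` ({1..par_n l} \<times> ?\<Sigma>)) \<times> {..<par_d l}"
    show "finite U"
      using K.finite_alphabet finite_lists_length_le[of "UNIV :: bool set" "in_len A"] by (simp add: U_def)
    fix F F' :: oracle_fun assume F: "\<And>s. s \<in> U \<Longrightarrow> F s = F' s"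
    show "?bad F = ?bad F'"
      by (rule good_output_determined[OF symbol]) (assumption, assumption, rule F, simp only: U_def)
  qed
  have "measure random_oracle {F \<in> space random_oracle.
      \<delta> \<le> accept_prob (frs_verify K g enc) F l h A \<and>
      min_entropy (accepted_pmf (frs_verify K g enc) F l h A) \<le> b}
    \<le> measure random_oracle {F \<in> space random_oracle. ?bad F}"
  proof (rule R.finite_measure_mono[OF subsetI bad_sets])
    fix F assume "F \<in> {F \<in> space random_oracle. \<delta> \<le> accept_prob (frs_verify K g enc) F l h A \<and>
      min_entropy (accepted_pmf (frs_verify K g enc) F l h A) \<le> b}"
    then show "F \<in> {F \<in> space random_oracle. ?bad F}"
      using low_entropy_imp_good_output[OF A \<delta>, of K g enc F l h b] unfolding \<epsilon>_def by simp
  qed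
  also have "\<dots> \<le> par_n l * (1 - p) ^ par_n l * (4 / \<epsilon> + real (par_q l) ^ s)"
  proof (rule prob_good_output_le[OF A eps l(1) K.finite_alphabet enc K.finite_frs_code symbol _ p(1) _ p(2)])
    fix S assume S: "S \<subseteq> {1..par_n l} \<times> ?\<Sigma>"
      and card_S: "card S * \<epsilon> \<le> 64 * (real (num_queries A) + 1) ^ 4 * par_n l"
    have "card S * \<epsilon> * par_m l \<le> 64 * (real (num_queries A) + 1) ^ 4 * par_n l * par_m l"
      using card_S by (intro mult_right_mono) auto
    also have "\<dots> < 8 ^ s * \<epsilon>" using heavy by (simp add: \<epsilon>_def)
    also have "card S * \<epsilon> * par_m l = real (card S * par_m l) * \<epsilon>" by simp
    finally have "real (card S * par_m l) * \<epsilon> < 8 ^ s * \<epsilon>" .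
    then have "real (card S * par_m l) < 8 ^ s" using eps by (simp only: mult_less_cancel_right_pos)
    then have "card S * par_m l < 8 ^ s" by (simp only: of_nat_less_numeral_power_cancel_iff)
    then have "card {xs \<in> ?C. 10 * sqrt (par_n l) \<le> card {i \<in> {1..par_n l}. (i, xs ! (i - 1)) \<in> S}} \<le> par_q l ^ s"
      by (rule K.frs_list_size[OF refl l(2) s S])
    then show "real (card {xs \<in> ?C. 10 * sqrt (par_n l) \<le> card {i \<in> {1..par_n l}. (i, xs ! (i - 1)) \<in> S}}) \<le> real (par_q l) ^ s"
      by (simp only: of_nat_le_iff of_nat_power[symmetric])
  qed (simp_all add: p_def)
  also have "\<dots> \<le> par_n l * exp (- sqrt (par_n l) / 80) * (4 / \<epsilon> + real (par_q l) ^ s)"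
    using p(3) eps by (intro mult_right_mono mult_left_mono) auto
  finally show ?thesis by (simp only: \<epsilon>_def)
qed

section \<open>Growth rates and the asymptotic conclusion\<close>

lemma lg_bounds:
  assumes "1 \<le> l"
  shows "(2 :: real) ^ lg l \<le> real l" "real l < 2 * 2 ^ lg l"
proof -
  have log: "0 \<le> \<lfloor>log 2 (real l)\<rfloor>" using assms by (simp add: le_floor_iff)
  have pow: "(2 :: real) ^ lg l = 2 powr \<lfloor>log 2 (real l)\<rfloor>"
    using log by (simp add: lg_def powr_real_of_int)
  have "2 powr \<lfloor>log 2 (real l)\<rfloor> \<le> 2 powr log 2 (real l)" by (intro powr_mono) auto
  then show "(2 :: real) ^ lg l \<le> real l" using assms by (simp add: pow)
  have "2 powr log 2 (real l) < 2 powr (\<lfloor>log 2 (real l)\<rfloor> + 1)" by (intro powr_less_mono) linarith+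
  then show "real l < 2 * 2 ^ lg l" using assms by (simp add: pow powr_add)
qed

lemma parameter_bounds:
  assumes "100 \<le> l"
  shows "2 \<le> par_n l" "32 \<le> par_q l" "even (par_q l)" "real l / 4 \<le> par_n l" "par_n l \<le> l"
    "real l / 2 \<le> par_m l" "par_m l \<le> 2 * l" "par_q l \<le> l ^ 2"
proof -
  define \<Lambda> :: nat where "\<Lambda> = 2 ^ lg l"
  have "real \<Lambda> \<le> real l" "real l < real (2 * \<Lambda>)"
    using lg_bounds[of l] assms by (simp_all add: \<Lambda>_def)
  then have L: "\<Lambda> \<le> l" "l < 2 * \<Lambda>" by (simp_all only: of_nat_le_iff of_nat_less_iff)
  have n: "par_n l = \<Lambda> - 1" by (simp add: par_n_eq \<Lambda>_def)
  have m: "par_m l = \<Lambda> + 1" by (simp add: par_m_def \<Lambda>_def)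
  have q: "par_q l = \<Lambda> ^ 2" by (simp add: par_q_def \<Lambda>_def mult.commute flip: power_mult)
  show "2 \<le> par_n l" "par_n l \<le> l" "real l / 4 \<le> par_n l" using L assms by (simp_all add: n of_nat_diff)
  show "real l / 2 \<le> par_m l" "par_m l \<le> 2 * l" using L assms by (simp_all add: m)
  show "par_q l \<le> l ^ 2" using L by (simp add: q power_mono)
  have "50 ^ 2 \<le> \<Lambda> ^ 2" using L assms by (intro power_mono) auto
  then show "32 \<le> par_q l" by (simp add: q)
  have "lg l \<noteq> 0" using L assms by (auto simp: \<Lambda>_def intro: ccontr)
  then show "even (par_q l)" by (simp add: par_q_def)
qed

text \<open>The left side is 2 to the power O(x^c), which c < c' makes negligible against the right
  side.\<close>

lemma heavy_bound_asymp:
  fixes c c' :: real assumes "0 < c" "c < c'" "c' < 1 / 2"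
  shows "\<forall>\<^sub>F x in at_top. 2048 * (2 powr (x powr c)) ^ 4 * x * x * x ^ e * 2 powr (x powr c) < 8 powr (x powr c')"
  using assms by real_asymp

text \<open>Both summands have logarithm of order at most x^c' * log x, and c' < 1/2 lets exp(- sqrt
  x / 160) absorb them together with every power of x.\<close>

lemma final_bound_asymp:
  fixes c c' :: real assumes "0 < c" "c < c'" "c' < 1 / 2"
  shows "\<forall>\<^sub>F x in at_top. x * exp (- sqrt x / 160) * (4 * (x ^ e * 2 powr (x powr c)) + x powr (2 * x powr c' + 2))
    \<le> 1 / x ^ e'"
proof -
  have "((\<lambda>x. x * exp (- sqrt x / 160) * (4 * (x ^ e * 2 powr (x powr c))) * x ^ e') \<longlongrightarrow> 0) at_top"
    using assms by real_asymp
  moreover have "((\<lambda>x. x * exp (- sqrt x / 160) * (x powr (2 * x powr c' + 2)) * x ^ e') \<longlongrightarrow> 0) at_top"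
    using assms by real_asymp
  ultimately have "\<forall>\<^sub>F x in at_top. x * exp (- sqrt x / 160) * (4 * (x ^ e * 2 powr (x powr c))) * x ^ e' +
      x * exp (- sqrt x / 160) * (x powr (2 * x powr c' + 2)) * x ^ e' < 1"
    by (intro order_tendstoD(2)[OF tendsto_add_zero]) auto
  then show ?thesis
    using eventually_gt_at_top[of 0]
  proof eventually_elim
    case (elim x)
    then show ?case by (simp add: pos_le_divide_eq algebra_simps)
  qed
qed

theorem corollary7p2:
  fixes K :: "nat \<Rightarrow> 'a ring"
    and \<gamma> :: "nat \<Rightarrow> 'a"
    and enc :: "nat \<Rightarrow> nat \<times> 'a list \<Rightarrow> bool list"
    and c :: real
    and g Q :: "nat \<Rightarrow> real"
    and h :: "nat \<Rightarrow> nat"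
  assumes field: "\<forall>\<^sub>F l in sequentially. field (K l) \<and> card (carrier (K l)) = par_q l"
    and generator: "\<forall>\<^sub>F l in sequentially. is_generator (K l) (\<gamma> l)"
    and encoding: "\<forall>\<^sub>F l in sequentially. inj_on (enc l) ({1..par_n l} \<times> alphabet (K l) l)"
    and c: "0 < c" "c < 1 / 2"
    and Q: "\<And>l. Q l \<le> 2 powr g l" "g \<in> o(\<lambda>l. real l powr c)"
    and h: "(\<lambda>l. real (h l)) \<in> o(\<lambda>l. real l powr c)"
  shows "certifiable_min_entropy (frs_verify K \<gamma> enc) Q h"
  unfolding certifiable_min_entropy_def
proof (intro allI impI)
  fix B :: "nat \<Rightarrow> nat \<Rightarrow> 'a list list query_algorithm" and e :: nat
  assume B: "\<forall>l. valid_algorithm (B l (h l)) \<and> real (num_queries (B l (h l))) \<le> Q l"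
  \<comment> \<open>The probability itself serves as the negligible bound.\<close>
  define \<nu> where "\<nu> l = \<P>(F in random_oracle.
    accept_prob (frs_verify K \<gamma> enc) F l (h l) (B l (h l)) \<ge> 1 / real l ^ e \<and>
    min_entropy (accepted_pmf (frs_verify K \<gamma> enc) F l (h l) (B l (h l))) \<le> real (h l))" for l
  \<comment> \<open>The midpoint of c and 1/2: above c, so that 8^s absorbs the query and entropy
    factors; below 1/2, so that q^s is absorbed by the exponential in sqrt \<lambda>.\<close>
  define c' where "c' = (c + 1 / 2) / 2"
  have c': "0 < c" "c < c'" "c' < 1 / 2" using c by (simp_all add: c'_def)
  have "negligible \<nu>"
    unfolding negligible_def
  proof
    fix e' :: nat
    \<comment> \<open>Little-o with constant 1: eventually h \<le> l^c, and next the same for the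
      exponent g of the query bound.\<close>
    have "\<forall>\<^sub>F l in sequentially. norm (real (h l)) \<le> 1 * norm (real l powr c)"
      by (rule landau_o.smallD[OF h]) simp
    moreover have "\<forall>\<^sub>F l in sequentially. norm (g l) \<le> 1 * norm (real l powr c)"
      by (rule landau_o.smallD[OF Q(2)]) simp
    moreover note field generator encoding
      eventually_compose_filterlim[OF heavy_bound_asymp[OF c', of e] filterlim_real_sequentially]
      eventually_compose_filterlim[OF final_bound_asymp[OF c', of e e'] filterlim_real_sequentially]
    \<comment> \<open>This yields 4 s \<le> m, as s is at most x^c' + 1 and m at least x /
      2.\<close>
    moreover have "\<forall>\<^sub>F x in at_top. 4 * (x powr c' + 1) \<le> x / 2" using c' by real_asymp
    note eventually_compose_filterlim[OF this filterlim_real_sequentially]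
    moreover note eventually_ge_at_top[of 100]
    ultimately show "\<forall>\<^sub>F l in sequentially. \<bar>\<nu> l\<bar> \<le> 1 / real l ^ e'"
    proof eventually_elim
      case (elim l)
      define x where "x = real l"
      define t where "t = (2 :: real) powr (x powr c)"
      define s where "s = nat \<lceil>x powr c'\<rceil>"
      define r where "r = real (num_queries (B l (h l))) + 1"
      define \<epsilon> where "\<epsilon> = 1 / real l ^ e * 2 powr - real (h l)"
      note par = parameter_bounds[OF elim(9)]
      have x: "100 \<le> x" using elim(9) by (simp add: x_def)
      have s: "x powr c' \<le> real s" "real s \<le> x powr c' + 1" "0 < s"
        using x by (simp_all add: s_def)
      have t: "1 \<le> t" by (simp add: t_def ge_one_powr_ge_zero)
      have "finite_field_generator (K l) (\<gamma> l) (par_q l)"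
        using elim(3,4) par(2,3) by (auto simp: finite_field_generator_def finite_field_generator_axioms_def)
      have gl: "g l \<le> x powr c" and hl: "real (h l) \<le> x powr c"
        using elim(1,2) by (simp_all add: x_def)
      have "real (num_queries (B l (h l))) \<le> 2 powr g l" using B Q(1) order_trans by blast
      also have "\<dots> \<le> t" unfolding t_def using gl by (intro powr_mono) auto
      finally have r: "0 \<le> r" "r \<le> 2 * t" using t by (simp_all add: r_def)
      have eps: "0 < \<epsilon>" using x by (simp add: \<epsilon>_def x_def)
      have "1 / \<epsilon> = x ^ e * 2 powr h l" by (simp add: \<epsilon>_def x_def powr_minus field_simps)
      also have "\<dots> \<le> x ^ e * t"
        unfolding t_def using hl x by (intro mult_left_mono powr_mono) auto
      finally have inv_eps: "1 / \<epsilon> \<le> x ^ e * t" .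
      \<comment> \<open>Q + 1 \<le> 2 t, n \<le> x and m \<le> 2 x produce the constant 64 * 2^4 * 2
        = 2048.\<close>
      have "64 * r ^ 4 * par_n l * par_m l \<le> 64 * (2 * t) ^ 4 * x * (2 * x)"
        using r x par(5,7) t by (intro mult_mono power_mono mult_nonneg_nonneg) (auto simp: x_def)
      also have "\<dots> = 2048 * t ^ 4 * x * x" by (simp add: power_mult_distrib)
      also have "\<dots> < 8 ^ s * \<epsilon>"
      proof -
        have "2048 * t ^ 4 * x * x * (1 / \<epsilon>) \<le> 2048 * t ^ 4 * x * x * (x ^ e * t)"
          using inv_eps t x by (intro mult_left_mono) auto
        also have "\<dots> < 8 powr (x powr c')" using elim(6) by (simp add: t_def x_def mult_ac)
        also have "\<dots> \<le> 8 powr s" using s(1) by (intro powr_mono) auto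
        finally show ?thesis using eps by (simp add: powr_realpow field_simps)
      qed
      finally have heavy: "64 * r ^ 4 * par_n l * par_m l < 8 ^ s * \<epsilon>" .
      have "real (4 * s) \<le> real (par_m l)" using s(2) elim(8) par(6) by (simp add: x_def)
      then have s4: "4 * s \<le> par_m l" by (simp only: of_nat_le_iff)
      have "\<nu> l \<le> par_n l * exp (- sqrt (par_n l) / 80) * (4 / \<epsilon> + real (par_q l) ^ s)"
        unfolding \<nu>_def \<epsilon>_def
        by (rule prob_low_entropy_le)
          (use B elim(5) par x s(3) s4 heavy \<open>finite_field_generator (K l) (\<gamma> l) (par_q l)\<close>
            in \<open>simp_all add: r_def \<epsilon>_def x_def\<close>)
      also have "\<dots> \<le> x * exp (- sqrt x / 160) * (4 * (x ^ e * t) + x powr (2 * x powr c' + 2))"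
      proof (intro mult_mono add_mono)
        show "par_n l \<le> x" using par(5) by (simp add: x_def)
        \<comment> \<open>From n \<ge> x / 4, sqrt n is at least half of sqrt x, which turns 80 into
          160.\<close>
        have "sqrt x / 2 = sqrt (x / 4)" by (simp add: real_sqrt_divide)
        also have "\<dots> \<le> sqrt (par_n l)" using par(4) by (simp add: x_def)
        finally show "exp (- sqrt (par_n l) / 80) \<le> exp (- sqrt x / 160)" by simp
        show "4 / \<epsilon> \<le> 4 * (x ^ e * t)" using inv_eps by simp
        have "real (par_q l) ^ s \<le> (x ^ 2) ^ s"
          using par(8) by (intro power_mono) (simp_all add: x_def flip: of_nat_power)
        also have "\<dots> = x powr (2 * s)" using x powr_realpow[of x "2 * s"] by (simp add: power_mult)
        also have "\<dots> \<le> x powr (2 * x powr c' + 2)" using s(2) x by (intro powr_mono) auto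
        finally show "real (par_q l) ^ s \<le> x powr (2 * x powr c' + 2)" .
      qed (use x eps in auto)
      also have "\<dots> \<le> 1 / x ^ e'" using elim(7) by (simp add: t_def x_def)
      finally show "\<bar>\<nu> l\<bar> \<le> 1 / real l ^ e'" by (simp add: \<nu>_def x_def)
    qed
  qed
  then show "\<exists>\<nu>. negligible \<nu> \<and> (\<forall>l. \<P>(F in random_oracle.
      accept_prob (frs_verify K \<gamma> enc) F l (h l) (B l (h l)) \<ge> 1 / real l ^ e \<and>
      min_entropy (accepted_pmf (frs_verify K \<gamma> enc) F l (h l) (B l (h l))) \<le> real (h l)) \<le> \<nu> l)"
    by (intro exI[of _ \<nu>]) (simp add: \<nu>_def)
qed

end
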